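(* Let the quantum Laplacian $\mathcal{L}=-\big[\sum_{1\le i,j\le n}d_{ij}\widetilde{\delta}_i^*\widetilde{\delta}_j\big]$ be the generator of an $L^2$-Markov semigroup, let $T$ be a unital Schwarz map on $\mathcal{M}$ satisfying DBII with respect to $\nu$, let $V=T-\mathrm{id}$, and let the induced operator $\widetilde{V}$ on $H_\nu$ be self-adjoint. Put $\mathcal{H}_q=\mathcal{L}+\widetilde{V}$ and let $(T_t^{(2)})$ be the $C_0$-semigroup on $L^2(\mathcal{M})\equiv H_\nu$ generated by $\mathcal{H}_q$. For any $f_0\in H_\nu$, $t\mapsto T_t^{(2)}(f_0)$ is then a solution of the equation $$f_t=-\Big[\sum_{1\le i,j\le n}d_{ij}\widetilde{\delta}_i^*\widetilde{\delta}_j\Big](f)+\widetilde{V}(f)=\mathcal{H}_q(f)$$ with initial condition $f(0)=f_0\in H_\nu$. For this solution we have that $T_t^{(2)}(f_0)\to(\mathbf{1}-s_{\mathcal{H}_q})(f_0)$ as $t\to\infty$, where $s_{\mathcal{H}_q}$ is the support projection of $\mathcal{H}_q$ (so $\mathbf 1-s_{\mathcal{H}_q}$ is the orthogonal projection onto $\ker\mathcal{H}_q$).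
   Context: $\mathcal{M}$ is a $\sigma$-finite von Neumann algebra with faithful normal state $\nu$. $\mathcal{M}\rtimes_\nu\mathbb{R}$ is the crossed product by the modular group of $\nu$, with dual action $\theta_s$ and canonical faithful normal semifinite trace $\tau$, $\tau\circ\theta_s=e^{-s}\tau$. Haagerup spaces: $L^p(\mathcal{M})=\{a\ \tau\text{-measurable}:\theta_s(a)=e^{-s/p}a\ \forall s\in\mathbb{R}\}$; $tr$ is the trace functional on $L^1(\mathcal{M})$, $\langle x,y\rangle=tr(y^*x)$ on $L^2(\mathcal{M})$. $h=\frac{d\widetilde\nu}{d\tau}\in L^1(\mathcal{M})_+$ ($\widetilde\nu$ the dual weight) is the density of $\nu$: $\nu(a)=tr(h^{1/2}ah^{1/2})$. $H_\nu$ is the GNS space with $\langle\eta(a),\eta(b)\rangle=\nu(b^*a)$, identified with $L^2(\mathcal{M})$ via $\eta(a)\leftrightarrow ah^{1/2}$. A bounded operator $S$ on $L^2(\mathcal{M})$ is $L^2$-Markov if $0\le x\le h^{1/2}$ implies $0\le S(x)\le h^{1/2}$, and $S(h^{1/2})=h^{1/2}$. Potential. A Schwarz map satisfies $T(a)^*T(a)\le T(a^*a)$. $T$ satisfies DBII with respect to $\nu$ if there is a positive map $T^\flat$ on $\mathcal{M}$ with $\nu(T(a)b)=\nu(aT^\flat(b))$ for all $a,b\in\mathcal{M}$. $\widetilde V$ is the bounded operator determined by $\widetilde V(\eta(a))=\eta(V(a))$. Laplacian. Derivations are *-derivations on $\mathcal{M}$ that are weak*-closed, weak*-densely defined and unital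 ($\mathbf1\in\mathrm{dom}(\delta)$). For a finite family $\mathcal{F}$ of derivations, $\mathcal{M}^{(m)}(\mathcal{F})$ is the set of $a\in\mathcal{M}$ with $a\in\mathrm{dom}(\delta_{i_1}\cdots\delta_{i_m})$ for all $\delta_{i_1},\dots,\delta_{i_m}\in\mathcal{F}$. A pair $(\delta,\delta^\flat)$ satisfies DBII if $\mathcal{M}^{(1)}(\{\delta,\delta^\flat\})$ is weak* dense and $\nu(a\delta(b))=\nu(\delta^\flat(a)b)$ for all $a,b$ in it. $\delta_1,\dots,\delta_n$ collectively satisfy DBII if there are derivations $\delta_i^\flat$ such that each $(\delta_i,\delta_i^\flat)$ satisfies DBII and, for $\mathcal{F}_{DB}=\{\delta_i,\delta_i^\flat\}_i$, the unital subalgebra $\mathcal{M}^{(2)}=\mathcal{M}^{(2)}(\mathcal{F}_{DB})$ is weak* dense. Throughout $\delta_1,\dots,\delta_n$ collectively satisfy DBII, $[d_{ij}]$ is a positive definite numerical matrix, $\widetilde\delta_i(\eta(a))=\eta(\delta_i(a))$ for $a\in\mathcal{M}^{(2)}$, $\sum d_{ij}\widetilde\delta_i^*\widetilde\delta_j$ has domain $\eta(\mathcal{M}^{(2)})$, and $[\,\cdot\,]$ denotes closure. The quantum Laplacian $\mathcal{L}$ is self-adjoint with $-\mathcal{L}$ positive definite. $f_t$ denotes the derivative in $t$ of $f:[0,\infty)\to H_\nu$. (The notation $T_t^{(2)}$ reflects that the semigroup generated by $\mathcal{H}_q$ is $L^2$-Markov and induced by Markov maps $T_t$ on $\mathcal{M}$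 via $h^{1/4}ah^{1/4}\mapsto h^{1/4}T_t(a)h^{1/4}$.) *)

theory Defs
  imports "HOL-Analysis.Analysis" "HOL-Library.Complex_Order"
begin

section \<open>Complex Hilbert spaces and operators\<close>

text \<open>The inner product is linear in its first argument.\<close>

class complex_hilbert = banach +
  fixes cscale :: "complex \<Rightarrow> 'a \<Rightarrow> 'a" (infixr \<open>*\<^sub>C\<close> 75)
    and cinner :: "'a \<Rightarrow> 'a \<Rightarrow> complex"
  assumes scaleR_cscale: "r *\<^sub>R x = complex_of_real r *\<^sub>C x"
    and cscale_add_right: "c *\<^sub>C (x + y) = c *\<^sub>C x + c *\<^sub>C y"
    and cscale_add_left: "(b + c) *\<^sub>C x = b *\<^sub>C x + c *\<^sub>C x"
    and cscale_cscale: "b *\<^sub>C c *\<^sub>C x = (b * c) *\<^sub>C x"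
    and cinner_add_left: "cinner (x + y) z = cinner x z + cinner y z"
    and cinner_cscale_left: "cinner (c *\<^sub>C x) y = c * cinner x y"
    and cinner_commute: "cinner x y = cnj (cinner y x)"
    and cinner_self: "cinner x x = complex_of_real ((norm x)\<^sup>2)"

instantiation complex :: complex_hilbert
begin

definition "cscale_complex (c::complex) x = c * x"
definition "cinner_complex (x::complex) y = x * cnj y"

instance
proof
  fix r :: real and b c x y z :: complex
  show "r *\<^sub>R x = complex_of_real r *\<^sub>C x"
    by (simp add: cscale_complex_def scaleR_conv_of_real)
  show "c *\<^sub>C (x + y) = c *\<^sub>C x + c *\<^sub>C y" "(b + c) *\<^sub>C x = b *\<^sub>C x + c *\<^sub>C x"
    "b *\<^sub>C c *\<^sub>C x = (b * c) *\<^sub>C x"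
    by (simp_all add: cscale_complex_def algebra_simps)
  show "cinner (x + y) z = cinner x z + cinner y z" "cinner (c *\<^sub>C x) y = c * cinner x y"
    by (simp_all add: cscale_complex_def cinner_complex_def algebra_simps)
  show "cinner x y = cnj (cinner y x)"
    by (simp add: cinner_complex_def mult.commute)
  show "cinner x x = complex_of_real ((norm x)\<^sup>2)"
    unfolding cinner_complex_def using complex_norm_square by metis
qed

end

definition bounded_clinear :: "('a::complex_hilbert \<Rightarrow> 'b::complex_hilbert) \<Rightarrow> bool" where
  "bounded_clinear T \<longleftrightarrow> bounded_linear T \<and> (\<forall>c x. T (c *\<^sub>C x) = c *\<^sub>C T x)"

definition adj :: "('a::complex_hilbert \<Rightarrow> 'a) \<Rightarrow> 'a \<Rightarrow> 'a" where
  "adj T = (THE S. \<forall>x y. cinner (T x) y = cinner x (S y))"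

definition op_pos :: "('a::complex_hilbert \<Rightarrow> 'a) \<Rightarrow> bool" where
  "op_pos T \<longleftrightarrow> (\<forall>x. 0 \<le> cinner (T x) x)"

definition op_le :: "('a::complex_hilbert \<Rightarrow> 'a) \<Rightarrow> ('a \<Rightarrow> 'a) \<Rightarrow> bool" where
  "op_le S T \<longleftrightarrow> op_pos (\<lambda>x. T x - S x)"

definition is_projection :: "('a::complex_hilbert \<Rightarrow> 'a) \<Rightarrow> bool" where
  "is_projection P \<longleftrightarrow> bounded_clinear P \<and> P \<circ> P = P \<and> adj P = P"

text \<open>Unbounded operators are represented by their graphs.\<close>

type_synonym 'a oper = "('a \<times> 'a) set"

definition graph_of :: "('a \<Rightarrow> 'a) \<Rightarrow> 'a oper" where
  "graph_of T = {(x, T x) | x. True}"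

definition op_of :: "'a oper \<Rightarrow> 'a \<Rightarrow> 'a" where
  "op_of A = (\<lambda>x. THE y. (x, y) \<in> A)"

definition op_add :: "'a::complex_hilbert oper \<Rightarrow> 'a oper \<Rightarrow> 'a oper" where
  "op_add A B = {(x, y + z) | x y z. (x, y) \<in> A \<and> (x, z) \<in> B}"

definition op_scale :: "complex \<Rightarrow> 'a::complex_hilbert oper \<Rightarrow> 'a oper" where
  "op_scale c A = {(x, c *\<^sub>C y) | x y. (x, y) \<in> A}"

definition op_adj :: "'a::complex_hilbert oper \<Rightarrow> 'a oper" where
  "op_adj A = {(y, z). \<forall>(x, w) \<in> A. cinner w y = cinner x z}"

definition self_adjoint :: "'a::complex_hilbert oper \<Rightarrow> bool" where
  "self_adjoint A \<longleftrightarrow> closure (Domain A) = UNIV \<and> op_adj A = A"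

definition pos_oper :: "'a::complex_hilbert oper \<Rightarrow> bool" where
  "pos_oper A \<longleftrightarrow> self_adjoint A \<and> (\<forall>(x, y) \<in> A. 0 \<le> cinner y x)"

definition closed_dd_oper :: "'a::complex_hilbert oper \<Rightarrow> bool" where
  "closed_dd_oper A \<longleftrightarrow>
     (\<forall>x y x' y'. (x, y) \<in> A \<and> (x', y') \<in> A \<longrightarrow> (x + x', y + y') \<in> A) \<and>
     (\<forall>c x y. (x, y) \<in> A \<longrightarrow> (c *\<^sub>C x, c *\<^sub>C y) \<in> A) \<and>
     single_valued A \<and> closed A \<and> closure (Domain A) = UNIV"

text \<open>The support projection of \<open>A\<close> is the least projection \<open>P\<close> with \<open>A P = A\<close>, domains included;
  the composite \<open>A P\<close> has domain \<open>{x. P x \<in> Domain A}\<close>.\<close>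

definition support_projection :: "'a::complex_hilbert oper \<Rightarrow> 'a \<Rightarrow> 'a" where
  "support_projection A = (THE P. is_projection P \<and> {(x, y). (P x, y) \<in> A} = A \<and>
     (\<forall>Q. is_projection Q \<and> {(x, y). (Q x, y) \<in> A} = A \<longrightarrow> op_le P Q))"

definition orth_projection_onto :: "('a::complex_hilbert \<Rightarrow> 'a) \<Rightarrow> 'a set \<Rightarrow> bool" where
  "orth_projection_onto P K \<longleftrightarrow> is_projection P \<and> range P = K"

definition ker_oper :: "'a::complex_hilbert oper \<Rightarrow> 'a set" where
  "ker_oper A = {x. (x, 0) \<in> A}"

subsection \<open>Borel functional calculus of self-adjoint operators\<close>

definition pvm :: "(real set \<Rightarrow> 'a::complex_hilbert \<Rightarrow> 'a) \<Rightarrow> bool" where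
  "pvm E \<longleftrightarrow> (\<forall>B \<in> sets borel. is_projection (E B)) \<and> E UNIV = id \<and>
     (\<forall>B. range B \<subseteq> sets borel \<and> disjoint_family B \<longrightarrow>
        (\<forall>x. (\<lambda>n::nat. E (B n) x) sums E (\<Union>n. B n) x))"

definition spectral_dist :: "(real set \<Rightarrow> 'a::complex_hilbert \<Rightarrow> 'a) \<Rightarrow> 'a \<Rightarrow> real measure" where
  "spectral_dist E x = measure_of UNIV (sets borel) (\<lambda>B. ennreal (Re (cinner (E B x) x)))"

text \<open>The operator \<open>\<integral> f dE\<close>; off the diagonal its form is recovered by polarization.\<close>

definition spectral_integral ::
  "(real set \<Rightarrow> 'a::complex_hilbert \<Rightarrow> 'a) \<Rightarrow> (real \<Rightarrow> complex) \<Rightarrow> 'a oper" where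
  "spectral_integral E f =
     (let D = {x. integrable (spectral_dist E x) (\<lambda>s. (cmod (f s))\<^sup>2)} in
      {(x, y). x \<in> D \<and> (\<forall>z \<in> D. cinner y z =
         (\<Sum>k<4. \<i> ^ k * (LINT s|spectral_dist E (x + \<i> ^ k *\<^sub>C z). f s)) / 4)})"

definition fun_calc :: "(real \<Rightarrow> complex) \<Rightarrow> 'a::complex_hilbert oper \<Rightarrow> 'a oper" where
  "fun_calc f A =
     spectral_integral (SOME E. pvm E \<and> spectral_integral E complex_of_real = A) f"

definition oper_sqrt :: "'a::complex_hilbert oper \<Rightarrow> 'a oper" where
  "oper_sqrt A = fun_calc (\<lambda>s. complex_of_real (sqrt s)) A"

definition imag_power :: "'a::complex_hilbert oper \<Rightarrow> real \<Rightarrow> 'a \<Rightarrow> 'a" where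
  "imag_power A t = op_of (fun_calc (\<lambda>s. complex_of_real s powr (\<i> * complex_of_real t)) A)"

subsection \<open>One-parameter semigroups\<close>

definition C0_semigroup :: "(real \<Rightarrow> 'a::complex_hilbert \<Rightarrow> 'a) \<Rightarrow> bool" where
  "C0_semigroup S \<longleftrightarrow> (\<forall>t\<ge>0. bounded_clinear (S t)) \<and> S 0 = id \<and>
     (\<forall>s\<ge>0. \<forall>t\<ge>0. S (s + t) = S s \<circ> S t) \<and>
     (\<forall>x. ((\<lambda>t. S t x) \<longlongrightarrow> x) (at_right 0))"

definition generator :: "(real \<Rightarrow> 'a::complex_hilbert \<Rightarrow> 'a) \<Rightarrow> 'a oper" where
  "generator S = {(x, y). ((\<lambda>t. (S t x - x) /\<^sub>R t) \<longlongrightarrow> y) (at_right 0)}"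

section \<open>Von Neumann algebras\<close>

definition commutant :: "('a::complex_hilbert \<Rightarrow> 'a) set \<Rightarrow> ('a \<Rightarrow> 'a) set" where
  "commutant S = {T. bounded_clinear T \<and> (\<forall>A \<in> S. T \<circ> A = A \<circ> T)}"

definition von_neumann_algebra :: "('a::complex_hilbert \<Rightarrow> 'a) set \<Rightarrow> bool" where
  "von_neumann_algebra M \<longleftrightarrow>
     M \<subseteq> Collect bounded_clinear \<and> adj ` M \<subseteq> M \<and> commutant (commutant M) = M"

definition pos_cone :: "('a::complex_hilbert \<Rightarrow> 'a) set \<Rightarrow> ('a \<Rightarrow> 'a) set" where
  "pos_cone M = {a \<in> M. op_pos a}"

definition sigma_finite_algebra :: "('a::complex_hilbert \<Rightarrow> 'a) set \<Rightarrow> bool" where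
  "sigma_finite_algebra M \<longleftrightarrow>
     (\<forall>P \<subseteq> M. (\<forall>p \<in> P. is_projection p \<and> p \<noteq> (\<lambda>x. 0)) \<and>
        (\<forall>p \<in> P. \<forall>q \<in> P. p \<noteq> q \<longrightarrow> p \<circ> q = (\<lambda>x. 0)) \<longrightarrow> countable P)"

definition predual :: "(('a::complex_hilbert \<Rightarrow> 'a) \<Rightarrow> complex) set" where
  "predual = {\<lambda>a. \<Sum>n. cinner (a (x n)) (y n) | x y :: nat \<Rightarrow> 'a.
     summable (\<lambda>n. (norm (x n))\<^sup>2) \<and> summable (\<lambda>n. (norm (y n))\<^sup>2)}"

definition weak_star :: "('a::complex_hilbert \<Rightarrow> 'a) set \<Rightarrow> ('a \<Rightarrow> 'a) topology" where
  "weak_star M = topology_generated_by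
     {{a \<in> M. \<phi> a \<in> U} | \<phi> U. \<phi> \<in> predual \<and> open U}"

definition normal_pos :: "('a::complex_hilbert \<Rightarrow> 'a) set \<Rightarrow> (('a \<Rightarrow> 'a) \<Rightarrow> complex) \<Rightarrow> bool" where
  "normal_pos M \<phi> \<longleftrightarrow> (\<exists>\<psi> \<in> predual. \<forall>a \<in> M. \<phi> a = \<psi> a) \<and> (\<forall>a \<in> pos_cone M. 0 \<le> \<phi> a)"

definition faithful_normal_state ::
  "('a::complex_hilbert \<Rightarrow> 'a) set \<Rightarrow> (('a \<Rightarrow> 'a) \<Rightarrow> complex) \<Rightarrow> bool" where
  "faithful_normal_state M \<nu> \<longleftrightarrow> normal_pos M \<nu> \<and> \<nu> id = 1 \<and>
     (\<forall>a \<in> pos_cone M. \<nu> a = 0 \<longrightarrow> a = (\<lambda>x. 0))"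

definition fns_trace ::
  "('a::complex_hilbert \<Rightarrow> 'a) set \<Rightarrow> (('a \<Rightarrow> 'a) \<Rightarrow> ennreal) \<Rightarrow> bool" where
  "fns_trace N \<tau> \<longleftrightarrow>
     (\<forall>a \<in> pos_cone N. \<forall>b \<in> pos_cone N. \<tau> (\<lambda>x. a x + b x) = \<tau> a + \<tau> b) \<and>
     (\<forall>a \<in> pos_cone N. \<forall>r\<ge>0. \<tau> (\<lambda>x. r *\<^sub>R a x) = ennreal r * \<tau> a) \<and>
     (\<forall>a \<in> N. \<tau> (adj a \<circ> a) = \<tau> (a \<circ> adj a)) \<and>
     (\<forall>a \<in> pos_cone N. \<tau> a = 0 \<longrightarrow> a = (\<lambda>x. 0)) \<and>
     (\<forall>D \<subseteq> pos_cone N. \<forall>a \<in> pos_cone N. D \<noteq> {} \<and>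
        (\<forall>b \<in> D. \<forall>c \<in> D. \<exists>e \<in> D. op_le b e \<and> op_le c e) \<and>
        (\<forall>b \<in> D. op_le b a) \<and> (\<forall>c \<in> pos_cone N. (\<forall>b \<in> D. op_le b c) \<longrightarrow> op_le a c) \<longrightarrow>
        \<tau> a = (SUP b \<in> D. \<tau> b)) \<and>
     (\<forall>a \<in> pos_cone N. a \<noteq> (\<lambda>x. 0) \<longrightarrow>
        (\<exists>b \<in> pos_cone N. b \<noteq> (\<lambda>x. 0) \<and> op_le b a \<and> \<tau> b < \<infinity>))"

definition affiliated :: "('a::complex_hilbert \<Rightarrow> 'a) set \<Rightarrow> 'a oper \<Rightarrow> bool" where
  "affiliated N A \<longleftrightarrow> (\<forall>u \<in> commutant N. \<forall>(x, y) \<in> A. (u x, u y) \<in> A)"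

definition trace_measurable ::
  "('a::complex_hilbert \<Rightarrow> 'a) set \<Rightarrow> (('a \<Rightarrow> 'a) \<Rightarrow> ennreal) \<Rightarrow> 'a oper \<Rightarrow> bool" where
  "trace_measurable N \<tau> A \<longleftrightarrow> closed_dd_oper A \<and> affiliated N A \<and>
     (\<forall>e>0. \<exists>p \<in> N. is_projection p \<and> range p \<subseteq> Domain A \<and> \<tau> (\<lambda>x. x - p x) \<le> ennreal e)"

section \<open>GNS space, modular group, crossed product and Haagerup spaces\<close>

text \<open>The type \<open>'g\<close> with the map \<open>\<eta>\<close> is the GNS space \<open>H\<^sub>\<nu>\<close>.\<close>

locale gns_space =
  fixes M :: "('h::complex_hilbert \<Rightarrow> 'h) set"
    and \<nu> :: "('h \<Rightarrow> 'h) \<Rightarrow> complex"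
    and \<eta> :: "('h \<Rightarrow> 'h) \<Rightarrow> 'g::complex_hilbert"
  assumes vna: "von_neumann_algebra M"
    and sigma_fin: "sigma_finite_algebra M"
    and state: "faithful_normal_state M \<nu>"
    and gns_inner: "\<lbrakk>a \<in> M; b \<in> M\<rbrakk> \<Longrightarrow> cinner (\<eta> a) (\<eta> b) = \<nu> (adj b \<circ> a)"
    and gns_dense: "closure (\<eta> ` M) = UNIV"
begin

definition gns_rep :: "('h \<Rightarrow> 'h) \<Rightarrow> 'g \<Rightarrow> 'g" where
  "gns_rep a = (THE p. bounded_clinear p \<and> (\<forall>b \<in> M. p (\<eta> b) = \<eta> (a \<circ> b)))"

text \<open>The closure of \<open>\<eta>(a) \<mapsto> \<eta>(a\<^sup>*)\<close> is antilinear, whence the form of its adjoint.\<close>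

definition tomita :: "'g oper" where
  "tomita = closure {(\<eta> a, \<eta> (adj a)) | a. a \<in> M}"

definition tomita_adj :: "'g oper" where
  "tomita_adj = {(y, z). \<forall>(x, w) \<in> tomita. cinner w y = cinner z x}"

definition modular_operator :: "'g oper" where
  "modular_operator = tomita O tomita_adj"

definition modular_group :: "real \<Rightarrow> ('h \<Rightarrow> 'h) \<Rightarrow> 'h \<Rightarrow> 'h" where
  "modular_group t a = (THE b. b \<in> M \<and> gns_rep b =
     imag_power modular_operator t \<circ> gns_rep a \<circ> imag_power modular_operator (- t))"

end

text \<open>The Hilbert space \<open>L\<^sup>2(\<real>, 'h)\<close> is a type \<open>'k\<close> with a map \<open>\<Phi>\<close> sending a
  square-integrable function to its class.  Strong measurability is pointwise approximation by
  simple functions, as \<open>'h\<close> need not be separable.\<close>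

definition square_integrable :: "(real \<Rightarrow> 'h::complex_hilbert) \<Rightarrow> bool" where
  "square_integrable f \<longleftrightarrow>
     (\<exists>F. (\<forall>n::nat. simple_function lborel (F n)) \<and> (\<forall>s. (\<lambda>n. F n s) \<longlonglongrightarrow> f s)) \<and>
     (\<integral>\<^sup>+ s. ennreal ((norm (f s))\<^sup>2) \<partial>lborel) < \<infinity>"

locale crossed_product = gns_space M \<nu> \<eta>
  for M :: "('h::complex_hilbert \<Rightarrow> 'h) set"
    and \<nu> :: "('h \<Rightarrow> 'h) \<Rightarrow> complex"
    and \<eta> :: "('h \<Rightarrow> 'h) \<Rightarrow> 'g::complex_hilbert" +
  fixes \<Phi> :: "(real \<Rightarrow> 'h) \<Rightarrow> 'k::complex_hilbert"
  assumes L2_inner: "\<lbrakk>square_integrable f; square_integrable g\<rbrakk> \<Longrightarrow>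
      cinner (\<Phi> f) (\<Phi> g) = (LINT s|lborel. cinner (f s) (g s))"
    and L2_surj: "\<Phi> ` Collect square_integrable = UNIV"
begin

definition L2_op :: "((real \<Rightarrow> 'h) \<Rightarrow> real \<Rightarrow> 'h) \<Rightarrow> 'k \<Rightarrow> 'k" where
  "L2_op K = (THE T. \<forall>f. square_integrable f \<longrightarrow> T (\<Phi> f) = \<Phi> (K f))"

definition embed :: "('h \<Rightarrow> 'h) \<Rightarrow> 'k \<Rightarrow> 'k" where
  "embed a = L2_op (\<lambda>f s. modular_group (- s) a (f s))"

definition shift :: "real \<Rightarrow> 'k \<Rightarrow> 'k" where
  "shift t = L2_op (\<lambda>f s. f (s - t))"

definition modulation :: "real \<Rightarrow> 'k \<Rightarrow> 'k" where
  "modulation s = L2_op (\<lambda>f t. exp (- \<i> * complex_of_real (s * t)) *\<^sub>C f t)"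

definition crossed :: "('k \<Rightarrow> 'k) set" where
  "crossed = commutant (commutant (embed ` M \<union> range shift))"

definition dual_action :: "real \<Rightarrow> ('k \<Rightarrow> 'k) \<Rightarrow> 'k \<Rightarrow> 'k" where
  "dual_action s x = modulation s \<circ> x \<circ> modulation (- s)"

definition dual_action_oper :: "real \<Rightarrow> 'k oper \<Rightarrow> 'k oper" where
  "dual_action_oper s A = {(modulation s x, modulation s y) | x y. (x, y) \<in> A}"

text \<open>The dual weight \<open>\<phi> \<circ> embed\<^sup>-\<^sup>1 \<circ> \<integral> \<theta>\<^sub>s ds\<close> of a normal positive functional.  The integral
  lies in the extended positive part of \<open>embed ` M\<close>, so it may be evaluated with any normal positive
  extension \<open>\<psi>\<close> of \<open>\<phi> \<circ> embed\<^sup>-\<^sup>1\<close> to the crossed product.\<close>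

definition dual_weight :: "(('h \<Rightarrow> 'h) \<Rightarrow> complex) \<Rightarrow> ('k \<Rightarrow> 'k) \<Rightarrow> ennreal" where
  "dual_weight \<phi> x =
     (let \<psi> = (SOME \<psi>. normal_pos crossed \<psi> \<and> (\<forall>a \<in> M. \<psi> (embed a) = \<phi> a))
      in \<integral>\<^sup>+ s. ennreal (Re (\<psi> (dual_action s x))) \<partial>lborel)"

text \<open>The density \<open>d\<phi>\<tilde>/d\<tau>\<close> is the positive affiliated operator \<open>k\<close> with dual weight
  \<open>\<tau>(k \<sqdot>)\<close>, where \<open>\<tau>(k x) = lim \<tau>(k\<^sub>\<epsilon>\<^sup>1\<^sup>/\<^sup>2 x k\<^sub>\<epsilon>\<^sup>1\<^sup>/\<^sup>2)\<close> for \<open>k\<^sub>\<epsilon> = k (1 + \<epsilon> k)\<^sup>-\<^sup>1\<close> with \<open>\<epsilon>\<close>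
  decreasing to 0.\<close>

definition weighted_trace ::
  "(('k \<Rightarrow> 'k) \<Rightarrow> ennreal) \<Rightarrow> 'k oper \<Rightarrow> ('k \<Rightarrow> 'k) \<Rightarrow> ennreal" where
  "weighted_trace \<tau> k x = (SUP e \<in> {0<..}.
     (let r = op_of (fun_calc (\<lambda>s. complex_of_real (sqrt (s / (1 + e * s)))) k)
      in \<tau> (r \<circ> x \<circ> r)))"

definition density ::
  "(('k \<Rightarrow> 'k) \<Rightarrow> ennreal) \<Rightarrow> (('h \<Rightarrow> 'h) \<Rightarrow> complex) \<Rightarrow> 'k oper" where
  "density \<tau> \<phi> = (THE k. pos_oper k \<and> affiliated crossed k \<and>
     (\<forall>x \<in> pos_cone crossed. dual_weight \<phi> x = weighted_trace \<tau> k x))"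

text \<open>Among the traces scaled by the dual action, the canonical one is singled out by
  \<open>(D\<nu>\<tilde> : D\<tau>)\<^sub>t = shift t\<close>, i.e. by \<open>h\<^sup>i\<^sup>t = shift t\<close> for \<open>h = d\<nu>\<tilde>/d\<tau>\<close>.\<close>

definition canonical_trace :: "(('k \<Rightarrow> 'k) \<Rightarrow> ennreal) \<Rightarrow> bool" where
  "canonical_trace \<tau> \<longleftrightarrow> fns_trace crossed \<tau> \<and>
     (\<forall>s. \<forall>x \<in> pos_cone crossed. \<tau> (dual_action s x) = ennreal (exp (- s)) * \<tau> x) \<and>
     (\<forall>t. imag_power (density \<tau> \<nu>) t = shift t)"

definition haagerup_space :: "(('k \<Rightarrow> 'k) \<Rightarrow> ennreal) \<Rightarrow> real \<Rightarrow> 'k oper set" where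
  "haagerup_space \<tau> p = {A. trace_measurable crossed \<tau> A \<and>
     (\<forall>s. dual_action_oper s A = op_scale (complex_of_real (exp (- s / p))) A)}"

text \<open>Sums and products of measurable operators are the closures of the algebraic ones.  The
  functional \<open>tr\<close> on \<open>L\<^sup>1\<close> sends the density of \<open>\<phi>\<close> to \<open>\<phi>(1)\<close>; a general element of \<open>L\<^sup>1\<close> is a
  combination of four densities of normal positive functionals.\<close>

definition strong_sum :: "'k oper \<Rightarrow> 'k oper \<Rightarrow> 'k oper" where
  "strong_sum A B = closure (op_add A B)"

definition strong_scale :: "complex \<Rightarrow> 'k oper \<Rightarrow> 'k oper" where
  "strong_scale c A = closure (op_scale c A)"

definition strong_prod :: "'k oper \<Rightarrow> 'k oper \<Rightarrow> 'k oper" where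
  "strong_prod A B = closure (B O A)"

definition tr :: "(('k \<Rightarrow> 'k) \<Rightarrow> ennreal) \<Rightarrow> 'k oper \<Rightarrow> complex" where
  "tr \<tau> A = (THE c. \<exists>\<phi>1 \<phi>2 \<phi>3 \<phi>4.
     normal_pos M \<phi>1 \<and> normal_pos M \<phi>2 \<and> normal_pos M \<phi>3 \<and> normal_pos M \<phi>4 \<and>
     A = strong_sum
           (strong_sum (density \<tau> \<phi>1) (strong_scale (- 1) (density \<tau> \<phi>2)))
           (strong_scale \<i> (strong_sum (density \<tau> \<phi>3) (strong_scale (- 1) (density \<tau> \<phi>4)))) \<and>
     c = \<phi>1 id - \<phi>2 id + \<i> * (\<phi>3 id - \<phi>4 id))"

end

text \<open>\<open>U\<close> is the identification of \<open>H\<^sub>\<nu>\<close> with \<open>L\<^sup>2(M)\<close> that sends \<open>\<eta>(a)\<close> to \<open>a h\<^sup>1\<^sup>/\<^sup>2\<close>.\<close>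

locale haagerup_setting = crossed_product M \<nu> \<eta> \<Phi>
  for M :: "('h::complex_hilbert \<Rightarrow> 'h) set"
    and \<nu> :: "('h \<Rightarrow> 'h) \<Rightarrow> complex"
    and \<eta> :: "('h \<Rightarrow> 'h) \<Rightarrow> 'g::complex_hilbert"
    and \<Phi> :: "(real \<Rightarrow> 'h) \<Rightarrow> 'k::complex_hilbert" +
  fixes \<tau> :: "('k \<Rightarrow> 'k) \<Rightarrow> ennreal"
    and U :: "'g \<Rightarrow> 'k oper"
  assumes canonical: "canonical_trace \<tau>"
    and U_bij: "bij_betw U UNIV (haagerup_space \<tau> 2)"
    and U_add: "U (x + y) = strong_sum (U x) (U y)"
    and U_scale: "U (c *\<^sub>C x) = strong_scale c (U x)"
    and U_inner: "cinner x y = tr \<tau> (strong_prod (op_adj (U y)) (U x))"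
    and U_eta: "a \<in> M \<Longrightarrow>
      U (\<eta> a) = strong_prod (graph_of (embed a)) (oper_sqrt (density \<tau> \<nu>))"
begin

abbreviation h_half :: "'k oper" where
  "h_half \<equiv> oper_sqrt (density \<tau> \<nu>)"

definition between_0_h_half :: "'k oper \<Rightarrow> bool" where
  "between_0_h_half A \<longleftrightarrow> pos_oper A \<and> pos_oper (strong_sum h_half (strong_scale (- 1) A))"

text \<open>Operators on \<open>L\<^sup>2(M)\<close> are written as operators on \<open>H\<^sub>\<nu>\<close>.\<close>

definition L2_Markov :: "('g \<Rightarrow> 'g) \<Rightarrow> bool" where
  "L2_Markov S \<longleftrightarrow> bounded_clinear S \<and>
     (\<forall>x. between_0_h_half (U x) \<longrightarrow> between_0_h_half (U (S x))) \<and>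
     (\<forall>x. U x = h_half \<longrightarrow> U (S x) = h_half)"

definition L2_Markov_semigroup :: "(real \<Rightarrow> 'g \<Rightarrow> 'g) \<Rightarrow> bool" where
  "L2_Markov_semigroup S \<longleftrightarrow> C0_semigroup S \<and> (\<forall>t\<ge>0. L2_Markov (S t))"

end

section \<open>Potentials\<close>

definition linear_map_on ::
  "('h::complex_hilbert \<Rightarrow> 'h) set \<Rightarrow> (('h \<Rightarrow> 'h) \<Rightarrow> 'h \<Rightarrow> 'h) \<Rightarrow> bool" where
  "linear_map_on M T \<longleftrightarrow> T ` M \<subseteq> M \<and>
     (\<forall>a \<in> M. \<forall>b \<in> M. T (\<lambda>x. a x + b x) = (\<lambda>x. T a x + T b x)) \<and>
     (\<forall>c. \<forall>a \<in> M. T (\<lambda>x. c *\<^sub>C a x) = (\<lambda>x. c *\<^sub>C T a x))"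

definition unital_schwarz_map ::
  "('h::complex_hilbert \<Rightarrow> 'h) set \<Rightarrow> (('h \<Rightarrow> 'h) \<Rightarrow> 'h \<Rightarrow> 'h) \<Rightarrow> bool" where
  "unital_schwarz_map M T \<longleftrightarrow> linear_map_on M T \<and> T id = id \<and>
     (\<forall>a \<in> M. op_le (adj (T a) \<circ> T a) (T (adj a \<circ> a)))"

definition map_DBII :: "('h::complex_hilbert \<Rightarrow> 'h) set \<Rightarrow> (('h \<Rightarrow> 'h) \<Rightarrow> complex) \<Rightarrow>
    (('h \<Rightarrow> 'h) \<Rightarrow> 'h \<Rightarrow> 'h) \<Rightarrow> bool" where
  "map_DBII M \<nu> T \<longleftrightarrow> (\<exists>Tb. linear_map_on M Tb \<and> Tb ` pos_cone M \<subseteq> pos_cone M \<and>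
     (\<forall>a \<in> M. \<forall>b \<in> M. \<nu> (T a \<circ> b) = \<nu> (a \<circ> Tb b)))"

definition induced_operator :: "('h::complex_hilbert \<Rightarrow> 'h) set \<Rightarrow>
    (('h \<Rightarrow> 'h) \<Rightarrow> 'g::complex_hilbert) \<Rightarrow> (('h \<Rightarrow> 'h) \<Rightarrow> 'h \<Rightarrow> 'h) \<Rightarrow> ('g \<Rightarrow> 'g) \<Rightarrow> bool" where
  "induced_operator M \<eta> V Vt \<longleftrightarrow> bounded_clinear Vt \<and> (\<forall>a \<in> M. Vt (\<eta> a) = \<eta> (V a))"

section \<open>Derivations and the quantum Laplacian\<close>

type_synonym 'h deriv = "('h \<Rightarrow> 'h) \<rightharpoonup> ('h \<Rightarrow> 'h)"

definition derivation :: "('h::complex_hilbert \<Rightarrow> 'h) set \<Rightarrow> 'h deriv \<Rightarrow> bool" where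
  "derivation M \<delta> \<longleftrightarrow> dom \<delta> \<subseteq> M \<and> ran \<delta> \<subseteq> M \<and> id \<in> dom \<delta> \<and>
     (\<forall>a a' b b'. \<delta> a = Some a' \<and> \<delta> b = Some b' \<longrightarrow>
        \<delta> (\<lambda>x. a x + b x) = Some (\<lambda>x. a' x + b' x) \<and>
        \<delta> (a \<circ> b) = Some (\<lambda>x. a' (b x) + a (b' x))) \<and>
     (\<forall>a a' c. \<delta> a = Some a' \<longrightarrow>
        \<delta> (\<lambda>x. c *\<^sub>C a x) = Some (\<lambda>x. c *\<^sub>C a' x) \<and> \<delta> (adj a) = Some (adj a')) \<and>
     weak_star M closure_of dom \<delta> = M \<and>
     closedin (prod_topology (weak_star M) (weak_star M)) {(a, b). \<delta> a = Some b}"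

text \<open>\<open>smooth_dom M m F\<close> is \<open>\<M>\<^sup>(\<^sup>m\<^sup>)(F)\<close>; the fold is the composite of the derivations in \<open>ds\<close> with
  its natural domain.\<close>

definition smooth_dom ::
  "('h::complex_hilbert \<Rightarrow> 'h) set \<Rightarrow> nat \<Rightarrow> 'h deriv set \<Rightarrow> ('h \<Rightarrow> 'h) set" where
  "smooth_dom M m F = {a \<in> M. \<forall>ds. length ds = m \<and> set ds \<subseteq> F \<longrightarrow>
     a \<in> dom (foldr (\<circ>\<^sub>m) ds Some)}"

definition pair_DBII :: "('h::complex_hilbert \<Rightarrow> 'h) set \<Rightarrow> (('h \<Rightarrow> 'h) \<Rightarrow> complex) \<Rightarrow>
    'h deriv \<Rightarrow> 'h deriv \<Rightarrow> bool" where
  "pair_DBII M \<nu> \<delta> \<delta>b \<longleftrightarrow>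
     weak_star M closure_of smooth_dom M 1 {\<delta>, \<delta>b} = M \<and>
     (\<forall>a \<in> smooth_dom M 1 {\<delta>, \<delta>b}. \<forall>b \<in> smooth_dom M 1 {\<delta>, \<delta>b}.
        \<nu> (a \<circ> the (\<delta> b)) = \<nu> (the (\<delta>b a) \<circ> b))"

definition collective_DBII :: "('h::complex_hilbert \<Rightarrow> 'h) set \<Rightarrow> (('h \<Rightarrow> 'h) \<Rightarrow> complex) \<Rightarrow>
    ('n::finite \<Rightarrow> 'h deriv) \<Rightarrow> ('n \<Rightarrow> 'h deriv) \<Rightarrow> bool" where
  "collective_DBII M \<nu> \<delta> \<delta>b \<longleftrightarrow>
     (\<forall>i. derivation M (\<delta> i) \<and> derivation M (\<delta>b i) \<and> pair_DBII M \<nu> (\<delta> i) (\<delta>b i)) \<and>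
     weak_star M closure_of smooth_dom M 2 (range \<delta> \<union> range \<delta>b) = M"

definition induced_deriv :: "(('h::complex_hilbert \<Rightarrow> 'h) \<Rightarrow> 'g::complex_hilbert) \<Rightarrow>
    ('h \<Rightarrow> 'h) set \<Rightarrow> 'h deriv \<Rightarrow> 'g oper" where
  "induced_deriv \<eta> M2 \<delta> = {(\<eta> a, \<eta> b) | a b. a \<in> M2 \<and> \<delta> a = Some b}"

definition posdef_matrix :: "complex^'n^'n \<Rightarrow> bool" where
  "posdef_matrix d \<longleftrightarrow>
     (\<forall>z. z \<noteq> 0 \<longrightarrow> 0 < (\<Sum>i\<in>UNIV. \<Sum>j\<in>UNIV. d $ i $ j * cnj (z $ i) * z $ j))"

text \<open>\<open>\<Sum>\<^sub>i\<^sub>j d\<^sub>i\<^sub>j D\<^sub>i\<^sup>* D\<^sub>j\<close> on the domain \<open>K\<close>.\<close>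

definition second_order_sum :: "complex^'n^'n \<Rightarrow> ('n::finite \<Rightarrow> 'g::complex_hilbert oper) \<Rightarrow>
    'g set \<Rightarrow> 'g oper" where
  "second_order_sum d D K = {(x, \<Sum>i\<in>UNIV. \<Sum>j\<in>UNIV. d $ i $ j *\<^sub>C z i j) | x z.
     x \<in> K \<and> (\<forall>i j. (x, z i j) \<in> D j O op_adj (D i))}"

definition closed_second_order :: "('h::complex_hilbert \<Rightarrow> 'h) set \<Rightarrow>
    (('h \<Rightarrow> 'h) \<Rightarrow> 'g::complex_hilbert) \<Rightarrow> complex^'n^'n \<Rightarrow>
    ('n::finite \<Rightarrow> 'h deriv) \<Rightarrow> ('n \<Rightarrow> 'h deriv) \<Rightarrow> 'g oper" where
  "closed_second_order M \<eta> d \<delta> \<delta>b =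
     (let M2 = smooth_dom M 2 (range \<delta> \<union> range \<delta>b)
      in closure (second_order_sum d (\<lambda>i. induced_deriv \<eta> M2 (\<delta> i)) (\<eta> ` M2)))"

definition quantum_laplacian :: "('h::complex_hilbert \<Rightarrow> 'h) set \<Rightarrow>
    (('h \<Rightarrow> 'h) \<Rightarrow> 'g::complex_hilbert) \<Rightarrow> complex^'n^'n \<Rightarrow>
    ('n::finite \<Rightarrow> 'h deriv) \<Rightarrow> ('n \<Rightarrow> 'h deriv) \<Rightarrow> 'g oper" where
  "quantum_laplacian M \<eta> d \<delta> \<delta>b = op_scale (- 1) (closed_second_order M \<eta> d \<delta> \<delta>b)"

section \<open>Solutions of the evolution equation\<close>

text \<open>A solution of \<open>f\<^sub>t = - A f + V f = H f\<close>, \<open>f(0) = f0\<close>, is continuous on \<open>[0,\<infinity>)\<close> and satisfies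
  the equation at every \<open>t > 0\<close>; at \<open>t = 0\<close> the equation only makes sense for \<open>f0\<close> in the domain of
  \<open>H\<close>, and is then required with the one-sided derivative.\<close>

definition evolution_solution :: "'g::complex_hilbert oper \<Rightarrow> ('g \<Rightarrow> 'g) \<Rightarrow> 'g oper \<Rightarrow>
    'g \<Rightarrow> (real \<Rightarrow> 'g) \<Rightarrow> bool" where
  "evolution_solution A V H f0 f \<longleftrightarrow> continuous_on {0..} f \<and> f 0 = f0 \<and>
     (\<forall>t\<ge>0. t > 0 \<or> f0 \<in> Domain H \<longrightarrow>
        (\<exists>y. (f t, y) \<in> A \<and> (f t, - y + V (f t)) \<in> H \<and>
             (f has_vector_derivative - y + V (f t)) (at t within {0..})))"

end

theory Submission
  imports Defs
begin

text \<open>The potential is dissipative: a self-adjoint \<open>V\<close> annihilates \<open>\<eta>(1)\<close>, so \<open>\<nu>\<close> is \<open>T\<close>-invariant and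
  the Schwarz inequality makes \<open>1 + V\<close> a contraction.  Hence \<open>H\<^sub>q\<close>, a bounded symmetric perturbation of
  the Laplacian, is self-adjoint and negative, and its semigroup \<open>S\<close> consists of symmetric
  contractions.  No spectral theorem is needed from there on.  An energy estimate gives
  \<open>2 t\<^sup>2 \<parallel>S\<^sub>t H\<^sub>q x\<parallel>\<^sup>2 \<le> \<parallel>x\<parallel>\<^sup>2\<close>, so \<open>S\<^sub>t\<close> maps everything into the domain of \<open>H\<^sub>q\<close> for \<open>t > 0\<close>; and
  \<open>\<parallel>S\<^sub>s x - S\<^sub>t x\<parallel>\<^sup>2 = \<parallel>S\<^sub>s x\<parallel>\<^sup>2 + \<parallel>S\<^sub>t x\<parallel>\<^sup>2 - 2 \<parallel>S\<^bsub>(s+t)/2\<^esub> x\<parallel>\<^sup>2\<close> together with the monotonicity of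
  \<open>\<parallel>S\<^sub>t x\<parallel>\<close> shows that \<open>S\<^sub>t x\<close> converges.  The limit is the orthogonal projection onto the kernel.\<close>

section \<open>Complex Hilbert spaces\<close>

lemma cinner_add_right:
  "cinner (x::'a::complex_hilbert) (y + z) = cinner x y + cinner x z"
  by (metis cinner_commute cinner_add_left complex_cnj_add)

lemma cinner_cscale_right:
  "cinner (x::'a::complex_hilbert) (c *\<^sub>C y) = cnj c * cinner x y"
  by (metis cinner_commute cinner_cscale_left complex_cnj_mult)

lemma cinner_scaleR_left: "cinner (r *\<^sub>R x) (y::'a::complex_hilbert) = r *\<^sub>R cinner x y"
  by (simp add: scaleR_cscale[of r x] cinner_cscale_left scaleR_conv_of_real)

lemma cinner_scaleR_right: "cinner x (r *\<^sub>R (y::'a::complex_hilbert)) = r *\<^sub>R cinner x y"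
  by (simp add: scaleR_cscale[of r y] cinner_cscale_right scaleR_conv_of_real)

lemma Re_cinner_self: "Re (cinner x x) = (norm (x::'a::complex_hilbert))\<^sup>2"
  by (simp add: cinner_self)

lemma cinner_minus_left: "cinner (- x) (y::'a::complex_hilbert) = - cinner x y"
  using cinner_scaleR_left[of "-1" x y] by simp

lemma cinner_minus_right: "cinner x (- (y::'a::complex_hilbert)) = - cinner x y"
  using cinner_scaleR_right[of x "-1" y] by simp

lemma cinner_diff_left: "cinner (x - y) (z::'a::complex_hilbert) = cinner x z - cinner y z"
  by (metis cinner_add_left cinner_minus_left diff_conv_add_uminus)

lemma cinner_diff_right: "cinner x (y - (z::'a::complex_hilbert)) = cinner x y - cinner x z"
  by (metis cinner_add_right cinner_minus_right diff_conv_add_uminus)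

lemma cinner_zero_left [simp]: "cinner 0 (y::'a::complex_hilbert) = 0"
  using cinner_scaleR_left[of 0 0 y] by simp

lemma cinner_zero_right [simp]: "cinner x (0::'a::complex_hilbert) = 0"
  using cinner_scaleR_right[of x 0 0] by simp

lemma Re_cinner_commute: "Re (cinner x y) = Re (cinner y (x::'a::complex_hilbert))"
  by (metis cinner_commute complex_cnj cnj.sel(1))

lemma norm_add_squared:
  "(norm (x + y))\<^sup>2 = (norm x)\<^sup>2 + 2 * Re (cinner x y) + (norm (y::'a::complex_hilbert))\<^sup>2"
proof -
  have "Re (cinner (x + y) (x + y)) = Re (cinner x x) + 2 * Re (cinner x y) + Re (cinner y y)"
    using Re_cinner_commute[of x y] by (simp add: cinner_add_left cinner_add_right)
  then show ?thesis by (simp add: Re_cinner_self)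
qed

lemma norm_diff_squared:
  "(norm (x - y))\<^sup>2 = (norm x)\<^sup>2 - 2 * Re (cinner x y) + (norm (y::'a::complex_hilbert))\<^sup>2"
  using norm_add_squared[of x "- y"] by (simp add: cinner_minus_right)

lemma cscale_zero_right [simp]: "c *\<^sub>C (0::'a::complex_hilbert) = 0"
  by (metis add_cancel_right_left cscale_add_right add.right_neutral)

lemma cscale_minus_right: "c *\<^sub>C (- x) = - (c *\<^sub>C (x::'a::complex_hilbert))"
  by (metis cscale_add_right cscale_zero_right add.right_inverse add_eq_0_iff2 neg_eq_iff_add_eq_0)

lemma cscale_diff_right: "c *\<^sub>C (x - y) = c *\<^sub>C x - c *\<^sub>C (y::'a::complex_hilbert)"
  by (metis cscale_add_right cscale_minus_right diff_conv_add_uminus)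

lemma norm_cscale: "norm (c *\<^sub>C x) = cmod c * norm (x::'a::complex_hilbert)"
proof -
  have "(norm (c *\<^sub>C x))\<^sup>2 = Re (c * cnj c * cinner x x)"
    by (simp add: Re_cinner_self[symmetric] cinner_cscale_left cinner_cscale_right mult_ac)
  also have "\<dots> = (cmod c * norm x)\<^sup>2"
    by (simp only: complex_norm_square[symmetric] cinner_self of_real_mult[symmetric] Re_complex_of_real power_mult_distrib)
  finally show ?thesis by (simp add: power2_eq_iff_nonneg)
qed

lemma bounded_clinear_cscale: "bounded_clinear ((*\<^sub>C) c :: 'a::complex_hilbert \<Rightarrow> 'a)"
  unfolding bounded_clinear_def
proof safe
  show "bounded_linear ((*\<^sub>C) c :: 'a \<Rightarrow> 'a)"
    by (rule bounded_linear_intro[where K="cmod c"])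
      (auto simp: cscale_add_right scaleR_cscale cscale_cscale norm_cscale mult.commute)
qed (simp add: cscale_cscale mult.commute)

text \<open>The squared norm of \<open>norm y *\<^sub>R x - norm x *\<^sub>R y\<close> factors as
  twice \<open>norm x * norm y\<close> times the desired difference; for nonzero vectors the
  positive factor cancels.\<close>

lemma Re_cinner_le: "Re (cinner x y) \<le> norm x * norm (y::'a::complex_hilbert)"
proof (cases "x = 0 \<or> y = 0")
  case False
  then have p: "norm x > 0" "norm y > 0" by auto
  have "0 \<le> (norm (norm y *\<^sub>R x - norm x *\<^sub>R y))\<^sup>2" by simp
  also have "\<dots> = 2 * (norm x * norm y) * (norm x * norm y - Re (cinner x y))"
    unfolding norm_diff_squared
    by (simp add: cinner_scaleR_left cinner_scaleR_right power_mult_distrib)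
      (simp add: algebra_simps power2_eq_square)
  finally show ?thesis using p mult_pos_pos[OF p] by (simp add: zero_le_mult_iff)
qed auto

text \<open>Multiplying \<open>x\<close> by a phase \<open>c\<close> of modulus one makes the inner
  product a nonnegative real, which reduces the claim to real parts.\<close>

lemma norm_cinner_le: "cmod (cinner x y) \<le> norm x * norm (y::'a::complex_hilbert)"
proof (cases "cinner x y = 0")
  case False
  define c where "c = cnj (cinner x y) / cmod (cinner x y)"
  have c: "cmod c = 1" using False by (simp add: c_def norm_divide)
  have "c * cinner x y = cmod (cinner x y)"
    using False complex_norm_square[of "cinner x y"]
    by (simp add: c_def field_simps power2_eq_square)
  then have "cmod (cinner x y) = Re (cinner (c *\<^sub>C x) y)"
    by (simp add: cinner_cscale_left)
  also have "\<dots> \<le> norm (c *\<^sub>C x) * norm y" by (rule Re_cinner_le)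
  finally show ?thesis by (simp add: norm_cscale c)
qed simp

interpretation cinner: bounded_bilinear "cinner :: 'a::complex_hilbert \<Rightarrow> 'a \<Rightarrow> complex"
  by unfold_locales
    (auto simp: cinner_add_left cinner_add_right cinner_scaleR_left cinner_scaleR_right
      intro!: exI[of _ 1] norm_cinner_le)

section \<open>Density arguments and Riesz representation\<close>

lemma dense_continuous_eq:
  fixes f g :: "'a::topological_space \<Rightarrow> 'b::t2_space"
  assumes "closure D = UNIV" "continuous_on UNIV f" "continuous_on UNIV g" "\<And>x. x \<in> D \<Longrightarrow> f x = g x"
  shows "f x = g x"
proof -
  have "closure D \<subseteq> {x. f x = g x}"
    using assms closed_Collect_eq[of f g] by (intro closure_minimal) auto
  then show ?thesis using assms(1) by auto
qed

lemma dense_continuous_le: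
  fixes f :: "'a::topological_space \<Rightarrow> real"
  assumes "closure D = UNIV" "continuous_on UNIV f" "continuous_on UNIV g" "\<And>x. x \<in> D \<Longrightarrow> f x \<le> g x"
  shows "f x \<le> g x"
proof -
  have "closure D \<subseteq> {x. f x \<le> g x}"
    using assms closed_Collect_le[of f g] by (intro closure_minimal) auto
  then show ?thesis using assms(1) by auto
qed

text \<open>Both sides are continuous in the test vector, so density admits \<open>y - z\<close> as
  a test vector, and its norm comes out as zero.\<close>

lemma cinner_dense_eqI:
  fixes y z :: "'a::complex_hilbert"
  assumes "closure D = UNIV" and "\<And>x. x \<in> D \<Longrightarrow> cinner y x = cinner z x"
  shows "y = z"
proof -
  have "cinner y (y - z) = cinner z (y - z)"
    by (rule dense_continuous_eq[OF assms(1) _ _ assms(2)])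
      (intro continuous_intros cinner.continuous_on)+
  then have "cinner (y - z) (y - z) = 0" by (simp add: cinner_diff_left)
  then show ?thesis by (simp add: cinner_self)
qed

lemma cinner_ext: "(\<And>z. cinner z x = cinner z y) \<Longrightarrow> x = (y::'a::complex_hilbert)"
  by (rule cinner_dense_eqI[of UNIV]) (auto, metis cinner_commute)

text \<open>The representing vector minimizes \<open>\<parallel>x\<parallel>\<^sup>2 - 2 Re (f x)\<close>; the parallelogram law makes minimizing
  sequences Cauchy.\<close>

lemma riesz_representation:
  fixes f :: "'a::complex_hilbert \<Rightarrow> complex"
  assumes f: "bounded_linear f" and fc: "\<And>c x. f (c *\<^sub>C x) = c * f x"
  obtains z where "\<And>x. f x = cinner x z"
proof -
  interpret f: bounded_linear f by fact
  obtain K where K: "\<And>x. norm (f x) \<le> norm x * K" using f.bounded by blast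
  define J where "J x = (norm x)\<^sup>2 - 2 * Re (f x)" for x
  have low: "J x \<ge> - K\<^sup>2" for x
  proof -
    have "Re (f x) \<le> norm x * K" using K[of x] complex_Re_le_cmod[of "f x"] by linarith
    moreover have "0 \<le> (norm x - K)\<^sup>2" by simp
    ultimately show ?thesis unfolding J_def by (simp add: power2_diff)
  qed
  define m where "m = Inf (range J)"
  have bdd: "bdd_below (range J)" using low by (auto intro!: bdd_belowI[of _ "- K\<^sup>2"])
  have m: "m \<le> J x" for x unfolding m_def using bdd by (intro cInf_lower) auto
  have "\<exists>x. J x < m + inverse (real (Suc n))" for n
    using cInf_lessD[of "range J" "m + inverse (real (Suc n))"] unfolding m_def by auto
  then obtain X where X: "\<And>n. J (X n) < m + inverse (real (Suc n))" by metis
  have par: "(norm (x - y))\<^sup>2 = 2 * J x + 2 * J y - 4 * J ((1/2) *\<^sub>R (x + y))" for x y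
    unfolding J_def norm_diff_squared
    by (simp add: power_mult_distrib norm_add_squared f.add f.scaleR power_divide)
      (simp add: field_simps f.add f.scaleR)
  have "Cauchy X"
  proof (rule metric_CauchyI)
    fix e :: real assume e: "e > 0"
    \<comment> \<open>With \<open>e^2 / 4\<close>, \<open>par\<close> bounds the squared distance by
      \<open>4 (m + e^2 / 4) - 4 m = e^2\<close>, as \<open>J\<close> at the midpoint is at least
      \<open>m\<close>.\<close>
    obtain N where N: "inverse (real (Suc N)) < e\<^sup>2 / 4" using reals_Archimedean[of "e\<^sup>2/4"] e by auto
    have J: "J (X n) < m + e\<^sup>2 / 4" if "n \<ge> N" for n
    proof -
      have "inverse (real (Suc n)) \<le> inverse (real (Suc N))" using that by (simp add: field_simps)
      then show ?thesis using X[of n] N by linarith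
    qed
    have "dist (X n) (X k) < e" if "n \<ge> N" "k \<ge> N" for n k
    proof -
      have "(norm (X n - X k))\<^sup>2 < e\<^sup>2"
        using par[of "X n" "X k"] J[OF that(1)] J[OF that(2)] m[of "(1/2) *\<^sub>R (X n + X k)"] by linarith
      then show ?thesis using e by (simp add: dist_norm power2_less_imp_less)
    qed
    then show "\<exists>N. \<forall>n\<ge>N. \<forall>k\<ge>N. dist (X n) (X k) < e" by blast
  qed
  then obtain z where z: "X \<longlonglongrightarrow> z" using Cauchy_convergent convergent_def by blast
  have "(\<lambda>n. J (X n)) \<longlonglongrightarrow> J z" unfolding J_def by (intro tendsto_intros f.tendsto z)
  moreover have "(\<lambda>n. m + inverse (real (Suc n))) \<longlonglongrightarrow> m + 0"
    by (intro tendsto_intros LIMSEQ_inverse_real_of_nat)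
  ultimately have Jz: "J z \<le> m" using X by (intro LIMSEQ_le) (auto intro: less_imp_le)
  have re: "Re (f y) = Re (cinner y z)" for y
  proof -
    define b where "b = 2 * (Re (cinner y z) - Re (f y))"
    \<comment> \<open>First variation: comparing \<open>J\<close> at the minimizer \<open>z\<close>
      and at \<open>z + r y\<close> leaves a quadratic in \<open>r\<close> whose linear coefficient
      \<open>b\<close> must vanish.\<close>
    have q: "0 \<le> r\<^sup>2 * (norm y)\<^sup>2 + r * b" for r
    proof -
      have "J z \<le> J (z + r *\<^sub>R y)" using Jz m by (rule order_trans)
      then show ?thesis
        using Re_cinner_commute[of z y] unfolding J_def norm_add_squared b_def
        by (simp add: f.add f.scaleR cinner_scaleR_right power_mult_distrib algebra_simps)
    qed
    have "b = 0"
    proof (rule ccontr)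
      assume b: "b \<noteq> 0"
      \<comment> \<open>At \<open>r = - b / s\<close> the quadratic equals
        \<open>- (b / s)^2\<close>; the summand 1 keeps \<open>s\<close> positive also for
        \<open>y = 0\<close>.\<close>
      define s where "s = (norm y)\<^sup>2 + 1"
      have s: "s > 0" unfolding s_def by (intro add_nonneg_pos) auto
      have "(- b / s)\<^sup>2 * (norm y)\<^sup>2 + (- b / s) * b = - (b / s)\<^sup>2"
        using s by (simp add: field_simps power2_eq_square) (simp add: s_def algebra_simps power2_eq_square)
      then have "0 \<le> - (b / s)\<^sup>2" using q[of "- b / s"] by argo
      moreover have "(b / s)\<^sup>2 > 0" using b s by simp
      ultimately show False by linarith
    qed
    then show ?thesis unfolding b_def by simp
  qed
  have "f y = cinner y z" for y
  proof (rule complex_eqI)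
    show "Im (f y) = Im (cinner y z)"
      using re[of "\<i> *\<^sub>C y"] by (simp add: fc cinner_cscale_left)
  qed (rule re)
  then show ?thesis by (rule that)
qed

section \<open>Adjoints and bounded operators\<close>

lemma adj_eqI:
  assumes "\<And>x y. cinner (T x) y = cinner x (S y)"
  shows "adj T = S"
  unfolding adj_def
proof (rule the_equality)
  fix S' assume S': "\<forall>x y. cinner (T x) y = cinner x (S' y)"
  show "S' = S"
    by (rule ext, rule cinner_ext) (metis assms S')
qed (use assms in blast)

text \<open>\<open>adj\<close> is a definite description; Riesz representation of the functionals
  \<open>cinner (T x) y\<close> of \<open>x\<close> shows that it denotes an operator.\<close>

lemma cinner_adj:
  fixes T :: "'a::complex_hilbert \<Rightarrow> 'a"
  assumes T: "bounded_clinear T"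
  shows "cinner (T x) y = cinner x (adj T y)"
proof -
  have "\<exists>z. \<forall>x. cinner (T x) y = cinner x z" for y
  proof -
    have "bounded_linear (\<lambda>x. cinner (T x) y)"
      using T bounded_linear_compose[OF cinner.bounded_linear_left] by (auto simp: bounded_clinear_def)
    then show ?thesis
      by (rule riesz_representation) (use T in \<open>auto simp: bounded_clinear_def cinner_cscale_left\<close>)
  qed
  then obtain S where S: "\<And>x y. cinner (T x) y = cinner x (S y)" by metis
  then show ?thesis using adj_eqI[OF S] by simp
qed

lemma bounded_clinear_add_arg: "bounded_clinear T \<Longrightarrow> T (x + y) = T x + T y"
  by (simp add: bounded_clinear_def linear_simps)

lemma bounded_clinear_diff_arg: "bounded_clinear T \<Longrightarrow> T (x - y) = T x - T y"
  by (simp add: bounded_clinear_def linear_simps)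

lemma bounded_clinear_id: "bounded_clinear id"
  by (simp add: bounded_clinear_def bounded_linear_ident[unfolded id_def[symmetric]] id_def)

lemma bounded_clinear_add: "bounded_clinear S \<Longrightarrow> bounded_clinear T \<Longrightarrow> bounded_clinear (\<lambda>x. S x + T x)"
  by (simp add: bounded_clinear_def bounded_linear_add cscale_add_right)

lemma bounded_clinear_diff: "bounded_clinear S \<Longrightarrow> bounded_clinear T \<Longrightarrow> bounded_clinear (\<lambda>x. S x - T x)"
  by (simp add: bounded_clinear_def bounded_linear_sub cscale_diff_right)

lemma bounded_clinear_comp: "bounded_clinear S \<Longrightarrow> bounded_clinear T \<Longrightarrow> bounded_clinear (S \<circ> T)"
  by (simp add: bounded_clinear_def bounded_linear_compose o_def)

section \<open>Strongly continuous semigroups\<close>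

locale c0_semigroup =
  fixes S :: "real \<Rightarrow> 'a::complex_hilbert \<Rightarrow> 'a"
  assumes C0: "C0_semigroup S"
begin

lemma zero: "S 0 x = x"
  using C0 by (simp add: C0_semigroup_def)

lemma semigroup: "s \<ge> 0 \<Longrightarrow> t \<ge> 0 \<Longrightarrow> S (s + t) x = S s (S t x)"
  using C0 by (simp add: C0_semigroup_def)

lemma bounded_clinear: "t \<ge> 0 \<Longrightarrow> bounded_clinear (S t)"
  using C0 by (simp add: C0_semigroup_def)

lemma bounded_linear: "t \<ge> 0 \<Longrightarrow> bounded_linear (S t)"
  using bounded_clinear by (auto simp: bounded_clinear_def)

lemma tendsto_at_0: "((\<lambda>t. S t x) \<longlongrightarrow> x) (at_right 0)"
  using C0 by (simp add: C0_semigroup_def)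

lemmas diff = linear_diff[OF bounded_linear.linear[OF bounded_linear]]
  and add = linear_add[OF bounded_linear.linear[OF bounded_linear]]
  and scaleR = linear_scale[OF bounded_linear.linear[OF bounded_linear]]

lemma cscale: "t \<ge> 0 \<Longrightarrow> S t (c *\<^sub>C x) = c *\<^sub>C S t x"
  using bounded_clinear by (auto simp: bounded_clinear_def)

text \<open>Baire category: strong continuity at 0 bounds each orbit by some \<open>n\<close> on
  \<open>[0, 1/(n+1)]\<close>, so the closed sets \<open>F n\<close> cover the space and one of them
  has interior. Differences of vectors in a ball inside it give a bound uniform in
  \<open>x\<close>.\<close>

lemma bounded_near_0:
  obtains k K where "k > 0" "K \<ge> 0" "\<And>t x. 0 \<le> t \<Longrightarrow> t \<le> k \<Longrightarrow> norm (S t x) \<le> K * norm x"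
proof -
  define F where "F n = {x. \<forall>t\<in>{0..inverse (real (Suc n))}. norm (S t x) \<le> real n}" for n
  have cl: "closed (F n)" for n
  proof -
    have "F n = (\<Inter>t\<in>{0..inverse (real (Suc n))}. {x. norm (S t x) \<le> real n})"
      by (auto simp: F_def)
    also have "closed \<dots>"
      by (intro closed_INT ballI closed_Collect_le continuous_intros
          linear_continuous_on bounded_linear) auto
    finally show ?thesis .
  qed
  have "\<exists>n. x \<in> F n" for x
  proof -
    have "eventually (\<lambda>t. dist (S t x) x < 1) (at_right 0)"
      using tendstoD[OF tendsto_at_0, of 1 x] by simp
    then obtain b where b: "b > 0" "\<And>t. 0 < t \<Longrightarrow> t < b \<Longrightarrow> dist (S t x) x < 1"
      unfolding eventually_at_right_field by auto
    obtain n1 where n1: "inverse (real (Suc n1)) < b" using reals_Archimedean b(1) by blast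
    obtain n2 where n2: "norm x + 1 \<le> real n2" using real_arch_simple by blast
    define n where "n = max n1 n2"
    have "inverse (real (Suc n)) \<le> inverse (real (Suc n1))" by (simp add: n_def field_simps)
    then have nb: "inverse (real (Suc n)) < b" using n1 by linarith
    have nn: "norm x + 1 \<le> real n" using n2 by (simp add: n_def)
    have "norm (S t x) \<le> real n" if "0 \<le> t" "t \<le> inverse (real (Suc n))" for t
    proof (cases "t = 0")
      case False
      then have "dist (S t x) x < 1" using b(2)[of t] that nb by auto
      then have "norm (S t x - x) < 1" by (simp add: dist_norm)
      then show ?thesis using nn norm_triangle_sub[of "S t x" x] by linarith
    qed (use nn zero in auto)
    then show ?thesis unfolding F_def by (intro exI[of _ n]) auto
  qed
  then have un: "\<Union>(range F) = UNIV" by blast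
  have "\<exists>n. interior (F n) \<noteq> {}"
  proof (rule ccontr)
    assume "\<not> ?thesis"
    then have "euclidean interior_of \<Union>(range F) = {}"
      using Met_TC.metric_Baire_category_alt[where \<G>="range F"] cl
      by (auto simp: mtopology_is_euclidean)
    then show False by (simp add: un)
  qed
  then obtain n a where "a \<in> interior (F n)" by blast
  then obtain r where r: "r > 0" "ball a r \<subseteq> F n"
    by (meson interior_subset open_contains_ball open_interior subset_trans)
  have "norm (S t x) \<le> (4 * n / r) * norm x" if t: "0 \<le> t" "t \<le> inverse (real (Suc n))" for t x
  proof (cases "x = 0")
    case True
    then show ?thesis using bounded_linear[OF t(1)] by (simp add: linear_simps)
  next
    case False
    \<comment> \<open>Scaled to length \<open>r / 2\<close>, the vector can be added to the centre
      \<open>a\<close> without leaving the ball; \<open>2 n / c\<close> is then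
      \<open>4 n / r * norm x\<close>.\<close>
    define c where "c = r / (2 * norm x)"
    have c: "c > 0" "norm (c *\<^sub>R x) = r / 2" using False r by (auto simp: c_def)
    have "a \<in> F n" "a + c *\<^sub>R x \<in> F n" using r c by (auto simp: dist_norm subset_iff)
    then have "norm (S t a) \<le> n" "norm (S t (a + c *\<^sub>R x)) \<le> n"
      using t by (auto simp: F_def)
    then have "norm (c *\<^sub>R S t x) \<le> 2 * n"
      using norm_triangle_ineq4[of "S t (a + c *\<^sub>R x)" "S t a"] by (simp add: add scaleR t)
    then have "norm (S t x) \<le> 2 * n / c" using c by (simp add: field_simps)
    then show ?thesis using False r by (simp add: c_def)
  qed
  then show ?thesis using r(1) by (intro that[of "inverse (real (Suc n))" "4 * n / r"]) auto
qed

text \<open>Induction on the number of steps of length \<open>k\<close>: the semigroup law composes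
  two bounds, and the maximum with \<open>K0\<close> covers the times still in
  \<open>[0, k]\<close>.\<close>

lemma bounded_on_interval:
  obtains K where "\<And>t x. 0 \<le> t \<Longrightarrow> t \<le> b \<Longrightarrow> norm (S t x) \<le> K * norm x"
proof -
  obtain k K0 where k: "k > 0" "K0 \<ge> 0" "\<And>t x. 0 \<le> t \<Longrightarrow> t \<le> k \<Longrightarrow> norm (S t x) \<le> K0 * norm x"
    using bounded_near_0 by blast
  have "\<exists>K\<ge>0. \<forall>t x. 0 \<le> t \<longrightarrow> t \<le> real n * k \<longrightarrow> norm (S t x) \<le> K * norm x" for n
  proof (induction n)
    case 0
    show ?case using k by (intro exI[of _ K0]) auto
  next
    case (Suc n)
    then obtain K where K0: "K \<ge> 0"
      and K: "\<And>t x. 0 \<le> t \<Longrightarrow> t \<le> real n * k \<Longrightarrow> norm (S t x) \<le> K * norm x" by blast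
    have "norm (S t x) \<le> max K0 (K * K0) * norm x" if t: "0 \<le> t" "t \<le> real (Suc n) * k" for t x
    proof (cases "t \<le> k")
      case True
      then have "norm (S t x) \<le> K0 * norm x" using t k by simp
      also have "\<dots> \<le> max K0 (K * K0) * norm x" by (intro mult_right_mono) auto
      finally show ?thesis .
    next
      case False
      have "norm (S t x) = norm (S (t - k) (S k x))" using semigroup[of "t - k" k x] False k(1) by simp
      also have "\<dots> \<le> K * norm (S k x)" using K False t by (simp add: algebra_simps)
      also have "\<dots> \<le> K * (K0 * norm x)"
        using k K0 by (intro mult_left_mono) auto
      also have "\<dots> \<le> max K0 (K * K0) * norm x"
        by (subst mult.assoc[symmetric], intro mult_right_mono) auto
      finally show ?thesis .
    qed
    then show ?case using k(2) by (intro exI[of _ "max K0 (K * K0)"]) auto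
  qed
  then obtain K where K: "\<And>n t x. 0 \<le> t \<Longrightarrow> t \<le> real n * k \<Longrightarrow> norm (S t x) \<le> K n * norm x"
    by metis
  obtain n where n: "b < real n * k" using ex_less_of_nat_mult[OF k(1)] by blast
  show ?thesis by (rule that[of "K n"]) (use n K[of _ n] in auto)
qed

text \<open>Time and vector may vary together: the local operator bound controls
  \<open>S (m s) (z s - y)\<close>, and the remaining term has a fixed vector.\<close>

lemma tendsto_apply:
  assumes m: "(m \<longlongrightarrow> t) F" "eventually (\<lambda>s. 0 \<le> m s) F"
    and St: "((\<lambda>s. S (m s) y) \<longlongrightarrow> S t y) F" and z: "(z \<longlongrightarrow> y) F"
  shows "((\<lambda>s. S (m s) (z s)) \<longlongrightarrow> S t y) F"
proof -
  obtain K where K: "\<And>s x. 0 \<le> s \<Longrightarrow> s \<le> t + 1 \<Longrightarrow> norm (S s x) \<le> K * norm x"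
    using bounded_on_interval by blast
  have "eventually (\<lambda>s. m s < t + 1) F" using m(1) by (rule order_tendstoD) simp
  with m(2) have "eventually (\<lambda>s. norm (S (m s) (z s - y)) \<le> K * norm (z s - y)) F"
    by eventually_elim (auto intro: K)
  moreover have "((\<lambda>s. K * norm (z s - y)) \<longlongrightarrow> K * norm (y - y)) F"
    by (intro tendsto_intros z)
  then have "((\<lambda>s. K * norm (z s - y)) \<longlongrightarrow> 0) F" by simp
  ultimately have "((\<lambda>s. S (m s) (z s - y)) \<longlongrightarrow> 0) F"
    by (rule Lim_null_comparison)
  then have "((\<lambda>s. S (m s) (z s - y) + S (m s) y) \<longlongrightarrow> 0 + S t y) F"
    by (intro tendsto_add St)
  moreover have "eventually (\<lambda>s. S (m s) (z s - y) + S (m s) y = S (m s) (z s)) F"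
    using m(2) by eventually_elim (simp add: diff)
  ultimately have "((\<lambda>s. S (m s) (z s)) \<longlongrightarrow> 0 + S t y) F" by (rule Lim_transform_eventually)
  then show ?thesis by simp
qed

lemma abs_diff_at_right_0:
  "filterlim (\<lambda>s. \<bar>s - t\<bar>) (at_right (0::real)) (at t within A)"
proof -
  have "((\<lambda>s. \<bar>s - t\<bar>) \<longlongrightarrow> \<bar>t - t\<bar>) (at t within A)" by (intro tendsto_intros)
  then show ?thesis
    unfolding filterlim_at by (auto simp: eventually_at_filter)
qed

text \<open>Pulling out the smaller time reduces increments on either side of \<open>t\<close> to
  increments from time 0, where only right limits are given.\<close>

lemma apply_diff:
  assumes "s \<ge> 0" "t \<ge> 0"
  shows "S s x - S t x = sgn (s - t) *\<^sub>R S (min s t) (S \<bar>s - t\<bar> x - x)"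
proof -
  have "min s t + \<bar>s - t\<bar> = max s t" by auto
  then have "S (min s t) (S \<bar>s - t\<bar> x - x) = S (max s t) x - S (min s t) x"
    using semigroup[of "min s t" "\<bar>s - t\<bar>" x] assms by (simp add: diff)
  then show ?thesis by (cases s t rule: linorder_cases) (auto simp: min_def max_def)
qed

lemma continuous: "continuous_on {0..} (\<lambda>t. S t x)"
  unfolding continuous_on_def
proof safe
  fix t :: real assume t: "0 \<le> t"
  obtain K where K: "\<And>s x. 0 \<le> s \<Longrightarrow> s \<le> t + 1 \<Longrightarrow> norm (S s x) \<le> K * norm x"
    using bounded_on_interval by blast
  have "((\<lambda>s. S \<bar>s - t\<bar> x) \<longlongrightarrow> x) (at t within {0..})"
    using filterlim_compose[OF tendsto_at_0 abs_diff_at_right_0] .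
  then have "((\<lambda>s. K * norm (S \<bar>s - t\<bar> x - x)) \<longlongrightarrow> K * norm (x - x)) (at t within {0..})"
    by (intro tendsto_intros)
  then have "((\<lambda>s. K * norm (S \<bar>s - t\<bar> x - x)) \<longlongrightarrow> 0) (at t within {0..})" by simp
  moreover have "eventually (\<lambda>s. norm (S s x - S t x) \<le> K * norm (S \<bar>s - t\<bar> x - x)) (at t within {0..})"
    unfolding eventually_at_filter
  proof (intro always_eventually allI impI)
    fix s assume "s \<noteq> t" "s \<in> {0..}"
    then show "norm (S s x - S t x) \<le> K * norm (S \<bar>s - t\<bar> x - x)"
      using t K[of "min s t" "S \<bar>s - t\<bar> x - x"] by (simp add: apply_diff abs_sgn_eq)
  qed
  ultimately show "((\<lambda>s. S s x) \<longlongrightarrow> S t x) (at t within {0..})"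
    by (intro LIM_zero_cancel[of _ "S t x"]) (rule Lim_null_comparison)
qed

lemma tendsto_S:
  assumes "(m \<longlongrightarrow> t) F" "t \<ge> 0" "eventually (\<lambda>s. 0 \<le> m s) F"
  shows "((\<lambda>s. S (m s) y) \<longlongrightarrow> S t y) F"
  using continuous_on_tendsto_compose[OF continuous assms(1)] assms by simp

section \<open>The generator and differentiability of orbits\<close>

lemma generator_iff:
  "(x, y) \<in> generator S \<longleftrightarrow> ((\<lambda>t. (S t x - x) /\<^sub>R t) \<longlongrightarrow> y) (at_right 0)"
  by (simp add: generator_def)

lemma generator_apply:
  assumes "(x, y) \<in> generator S" "t \<ge> 0"
  shows "(S t x, S t y) \<in> generator S"
proof -
  have "((\<lambda>h. S t ((S h x - x) /\<^sub>R h)) \<longlongrightarrow> S t y) (at_right 0)"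
    using bounded_linear.tendsto[OF bounded_linear[OF assms(2)] assms(1)[unfolded generator_iff]] .
  moreover have "S t ((S h x - x) /\<^sub>R h) = (S h (S t x) - S t x) /\<^sub>R h" if "h > 0" for h
    using semigroup[of t h x] semigroup[of h t x] that assms(2)
    by (simp add: scaleR diff add.commute)
  then have "eventually (\<lambda>h. S t ((S h x - x) /\<^sub>R h) = (S h (S t x) - S t x) /\<^sub>R h) (at_right 0)"
    by (auto simp: eventually_at_filter intro!: always_eventually)
  ultimately show ?thesis unfolding generator_iff by (rule Lim_transform_eventually)
qed

lemma has_vector_derivative:
  assumes "(x, y) \<in> generator S" "t \<ge> 0"
  shows "((\<lambda>t. S t x) has_vector_derivative S t y) (at t within {0..})"
  unfolding has_vector_derivative_def has_derivative_within
proof (intro conjI bounded_linear_scaleR_left)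
  let ?F = "at t within {0..}"
  \<comment> \<open>Difference quotient of the orbit between \<open>s\<close> and \<open>t\<close>
    with the smaller time pulled out. Both its time and its vector move with \<open>s\<close>,
    whence \<open>tendsto_apply\<close>.\<close>
  define q where "q s = S (min s t) ((S \<bar>s - t\<bar> x - x) /\<^sub>R \<bar>s - t\<bar>)" for s
  have m: "((\<lambda>s. min s t) \<longlongrightarrow> t) ?F"
    using tendsto_min[OF tendsto_ident_at tendsto_const[of t], of t "{0..}"] by simp
  have ev: "eventually (\<lambda>s. 0 \<le> min s t) ?F"
    using assms(2) by (auto simp: eventually_at_filter)
  have "(q \<longlongrightarrow> S t y) ?F"
    unfolding q_def
    by (rule tendsto_apply[OF m ev tendsto_S[OF m assms(2) ev]])
      (use filterlim_compose[OF assms(1)[unfolded generator_iff] abs_diff_at_right_0] in simp)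
  then have "((\<lambda>s. norm (q s - S t y)) \<longlongrightarrow> norm (S t y - S t y)) ?F" by (intro tendsto_intros)
  then have lim: "((\<lambda>s. norm (q s - S t y)) \<longlongrightarrow> 0) ?F" by simp
  show "((\<lambda>s. (1 / norm (s - t)) *\<^sub>R (S s x - (S t x + (s - t) *\<^sub>R S t y))) \<longlongrightarrow> 0) ?F"
  proof (rule Lim_null_comparison[OF _ lim], unfold eventually_at_filter,
      intro always_eventually allI impI)
    fix s assume s: "s \<noteq> t" "s \<in> {0..}"
    have "S s x - S t x = sgn (s - t) *\<^sub>R (\<bar>s - t\<bar> *\<^sub>R q s)"
      using s assms(2) by (simp add: apply_diff q_def scaleR)
    also have "\<dots> = (s - t) *\<^sub>R q s" by (simp add: sgn_mult_abs)
    finally have "S s x - (S t x + (s - t) *\<^sub>R S t y) = (s - t) *\<^sub>R (q s - S t y)"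
      by (simp add: algebra_simps)
    then show "norm ((1 / norm (s - t)) *\<^sub>R (S s x - (S t x + (s - t) *\<^sub>R S t y)))
        \<le> norm (q s - S t y)"
      using s by simp
  qed
qed

lemma generator_diff:
  assumes "(x, y) \<in> generator S" "(x', y') \<in> generator S"
  shows "(x - x', y - y') \<in> generator S"
proof -
  have "((\<lambda>t. (S t x - x) /\<^sub>R t - (S t x' - x') /\<^sub>R t) \<longlongrightarrow> y - y') (at_right 0)"
    using assms unfolding generator_iff by (rule tendsto_diff)
  moreover have "eventually (\<lambda>t. (S t x - x) /\<^sub>R t - (S t x' - x') /\<^sub>R t
      = (S t (x - x') - (x - x')) /\<^sub>R t) (at_right 0)"
    by (auto simp: eventually_at_filter diff algebra_simps intro!: always_eventually)
  ultimately show ?thesis unfolding generator_iff by (rule Lim_transform_eventually)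
qed

end

section \<open>Semigroups with a negative self-adjoint generator\<close>

locale negative_semigroup = c0_semigroup S for S :: "real \<Rightarrow> 'a::complex_hilbert \<Rightarrow> 'a" +
  assumes self_adj: "self_adjoint (generator S)"
    and negative: "(x, y) \<in> generator S \<Longrightarrow> Re (cinner y x) \<le> 0"
begin

lemma dense: "closure (Domain (generator S)) = UNIV"
  using self_adj by (simp add: self_adjoint_def)

text \<open>Self-adjointness as a membership test: forwards it is symmetry, backwards it places a
  vector in the domain on the strength of weak identities alone.\<close>

lemma in_generator_iff:
  "(y, z) \<in> generator S \<longleftrightarrow> (\<forall>(x, w) \<in> generator S. cinner w y = cinner x z)"
proof -
  have "generator S = op_adj (generator S)" using self_adj by (simp add: self_adjoint_def)
  then have "(y, z) \<in> generator S \<longleftrightarrow> (y, z) \<in> op_adj (generator S)" by simp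
  then show ?thesis by (simp add: op_adj_def)
qed

lemma generator_symmetric:
  "(x, w) \<in> generator S \<Longrightarrow> (y, z) \<in> generator S \<Longrightarrow> cinner w y = cinner x z"
  using in_generator_iff by blast

text \<open>\<open>cinner (S s x) (S (t - s) y)\<close> has zero derivative in \<open>s\<close>, as
  the two terms of the product rule cancel by symmetry of the generator; the claim compares
  \<open>s = 0\<close> with \<open>s = t\<close>.\<close>

lemma symmetric_on_Domain:
  assumes x: "(x, x') \<in> generator S" and y: "(y, y') \<in> generator S" and t: "t \<ge> 0"
  shows "cinner (S t x) y = cinner x (S t y)"
proof -
  have "((\<lambda>s. cinner (S s x) (S (t - s) y)) has_vector_derivative 0) (at s within {0..t})"
    if s: "s \<in> {0..t}" for s
  proof -
    have 1: "((\<lambda>s. S s x) has_vector_derivative S s x') (at s within {0..t})"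
      using has_vector_derivative[OF x, of s] s by (auto intro: has_vector_derivative_within_subset)
    have 2: "((\<lambda>s. t - s) has_vector_derivative - 1) (at s within {0..t})"
      by (auto intro!: derivative_eq_intros)
    have "((\<lambda>s. S s y) has_vector_derivative S (t - s) y') (at (t - s) within (-) t ` {0..t})"
      using has_vector_derivative[OF y, of "t - s"] s by (auto intro: has_vector_derivative_within_subset)
    from vector_diff_chain_within[OF 2 this]
    have 3: "((\<lambda>s. S (t - s) y) has_vector_derivative - S (t - s) y') (at s within {0..t})"
      by (simp add: o_def)
    have "cinner (S s x') (S (t - s) y) = cinner (S s x) (S (t - s) y')"
      using generator_symmetric generator_apply x y s by simp
    then show ?thesis
      using cinner.has_vector_derivative[OF 1 3] by (simp add: cinner_minus_right)
  qed
  then have "cinner (S 0 x) (S (t - 0) y) = cinner (S t x) (S (t - t) y)"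
    using t has_derivative_zero_unique[of "{0..t}" "\<lambda>s. cinner (S s x) (S (t - s) y)" 0 t]
    by (simp add: has_vector_derivative_def)
  then show ?thesis by (simp add: zero)
qed

lemma symmetric:
  assumes t: "t \<ge> 0"
  shows "cinner (S t x) y = cinner x (S t y)"
proof -
  have c: "continuous_on UNIV (S t)" using t by (intro linear_continuous_on bounded_linear)
  have *: "cinner (S t x) y = cinner x (S t y)" if "x \<in> Domain (generator S)" for x
    by (rule dense_continuous_eq[OF dense, where f="\<lambda>y. cinner (S t x) y" and g="\<lambda>y. cinner x (S t y)"])
      (use c that symmetric_on_Domain t in
        \<open>auto intro: cinner.continuous_on continuous_on_const continuous_on_id\<close>)
  show ?thesis
    by (rule dense_continuous_eq[OF dense, where f="\<lambda>x. cinner (S t x) y" and g="\<lambda>x. cinner x (S t y)"])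
      (use c * in \<open>auto intro: cinner.continuous_on continuous_on_const continuous_on_id\<close>)
qed

text \<open>The squared norm of the orbit has derivative
  \<open>2 * Re (cinner (S s x') (S s x))\<close>, which is nonpositive because the orbit stays in
  the domain.\<close>

lemma contraction_on_Domain:
  assumes x: "(x, x') \<in> generator S" and t: "t \<ge> 0"
  shows "norm (S t x) \<le> norm x"
proof -
  have der: "((\<lambda>s. Re (cinner (S s x) (S s x))) has_real_derivative 2 * Re (cinner (S s x') (S s x))) (at s)"
    if s: "0 < s" for s
  proof -
    have "at s within {0..} = at s" using s by (intro at_within_interior) (simp add: interior_Ici)
    then have 1: "((\<lambda>s. S s x) has_vector_derivative S s x') (at s)"
      using has_vector_derivative[OF x, of s] s by simp
    show ?thesis
      using bounded_linear.has_vector_derivative[OF bounded_linear_Re cinner.has_vector_derivative[OF 1 1]]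
        Re_cinner_commute[of "S s x" "S s x'"]
      by (simp add: has_real_derivative_iff_has_vector_derivative)
  qed
  have neg: "2 * Re (cinner (S s x') (S s x)) \<le> 0" if "s > 0" for s
    using negative generator_apply[OF x] that by simp
  have cont: "continuous_on {0..t} (\<lambda>s. Re (cinner (S s x) (S s x)))"
    by (intro continuous_on_Re cinner.continuous_on continuous_on_subset[OF continuous]) auto
  have "Re (cinner (S t x) (S t x)) \<le> Re (cinner (S 0 x) (S 0 x))"
    by (rule DERIV_nonpos_imp_decreasing_open[OF t _ cont]) (rule exI, rule conjI, erule der, erule neg)
  then show ?thesis by (simp add: Re_cinner_self zero)
qed

lemma contraction:
  assumes t: "t \<ge> 0"
  shows "norm (S t x) \<le> norm x"
  by (rule dense_continuous_le[OF dense, where f="\<lambda>x. norm (S t x)" and g=norm])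
    (use contraction_on_Domain t linear_continuous_on[OF bounded_linear[OF t]] in
      \<open>auto intro: continuous_on_norm continuous_on_norm_id\<close>)

lemma cinner_S_double: "t \<ge> 0 \<Longrightarrow> cinner (S (2 * t) x) y = cinner (S t x) (S t y)"
  using semigroup[of t t x] symmetric[of t "S t x" y] by simp

text \<open>With \<open>u = S s x\<close> and \<open>c = \<parallel>S t x'\<parallel>\<^sup>2\<close>, the function
  \<open>\<parallel>u\<parallel>\<^sup>2 - 2 s \<langle>A u, u\<rangle> + 2 c s\<^sup>2\<close> has derivative \<open>4 s (c - \<parallel>A u\<parallel>\<^sup>2)\<close>, which is not positive for
  \<open>s \<le> t\<close>.\<close>

lemma smoothing_estimate:
  assumes x: "(x, x') \<in> generator S" and t: "t > 0"
  shows "2 * t\<^sup>2 * (norm (S t x'))\<^sup>2 \<le> (norm x)\<^sup>2"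
proof -
  define c where "c = (norm (S t x'))\<^sup>2"
  define f where "f s = Re (cinner (S s x) (S s x))" for s
  \<comment> \<open>For positive \<open>s\<close> this is the real part of
    \<open>cinner (S s x') (S s x)\<close>. Moving all the time onto \<open>x\<close> allows
    differentiation although \<open>x'\<close> need not lie in the domain.\<close>
  define g where "g s = Re (cinner (S (2 * s) x) x')" for s
  define G where "G s = f s - 2 * s * g s + 2 * c * s\<^sup>2" for s
  define D where "D s = 4 * s * (c - (norm (S s x'))\<^sup>2)" for s
  have der: "(G has_real_derivative D s) (at s)" if s: "0 < s" for s
  proof -
    have at: "at s within {0..} = at s" "at (2 * s) within {0..} = at (2 * s)"
      using s by (auto intro!: at_within_interior simp: interior_Ici)
    then have 1: "((\<lambda>s. S s x) has_vector_derivative S s x') (at s)"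
      using has_vector_derivative[OF x, of s] s by simp
    have "((\<lambda>s. S s x) has_vector_derivative S (2 * s) x') (at (2 * s))"
      using has_vector_derivative[OF x, of "2 * s"] s at by simp
    moreover have "((\<lambda>s. 2 * s) has_vector_derivative 2) (at s)"
      by (auto intro!: derivative_eq_intros)
    ultimately
    have 2: "((\<lambda>s. S (2 * s) x) has_vector_derivative 2 *\<^sub>R S (2 * s) x') (at s)"
      using vector_diff_chain_at[of "\<lambda>s. 2 * s" 2 s "\<lambda>s. S s x"] by (simp add: o_def)
    have "g s = Re (cinner (S s x') (S s x))"
      using s Re_cinner_commute by (simp add: g_def cinner_S_double)
    then have 3: "(f has_real_derivative 2 * g s) (at s)"
      using bounded_linear.has_vector_derivative[OF bounded_linear_Re cinner.has_vector_derivative[OF 1 1]]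
        Re_cinner_commute[of "S s x" "S s x'"]
      by (simp add: has_real_derivative_iff_has_vector_derivative f_def[abs_def])
    have 4: "(g has_real_derivative 2 * (norm (S s x'))\<^sup>2) (at s)"
      using bounded_linear.has_vector_derivative[OF bounded_linear_Re
          cinner.has_vector_derivative[OF 2 has_vector_derivative_const[of x']]] s
      by (simp add: has_real_derivative_iff_has_vector_derivative cinner_scaleR_left cinner_S_double
          Re_cinner_self g_def[abs_def])
    show ?thesis
      unfolding G_def D_def
      by (auto intro!: derivative_eq_intros 3 4 simp: algebra_simps)
  qed
  have neg: "D s \<le> 0" if s: "0 < s" "s < t" for s
  proof -
    have "norm (S t x') \<le> norm (S s x')"
      using contraction[of "t - s" "S s x'"] semigroup[of "t - s" s x'] s by simp
    then have "c \<le> (norm (S s x'))\<^sup>2" unfolding c_def by (rule power_mono) simp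
    then show ?thesis using s by (simp add: D_def mult_nonneg_nonpos)
  qed
  have cont: "continuous_on {0..t} G"
    unfolding G_def f_def g_def
    by (intro continuous_on_add continuous_on_diff continuous_on_mult continuous_on_const
        continuous_on_id continuous_on_power continuous_on_Re cinner.continuous_on
        continuous_on_subset[OF continuous] continuous_on_compose2[OF continuous]) auto
  have "G t \<le> G 0"
    by (rule DERIV_nonpos_imp_decreasing_open[OF less_imp_le[OF t] _ cont])
      (rule exI, rule conjI, erule der, erule neg)
  moreover have "G 0 = (norm x)\<^sup>2" by (simp add: G_def f_def zero Re_cinner_self)
  \<comment> \<open>At time \<open>t\<close> the terms \<open>f t\<close> and
    \<open>- 2 * t * g t\<close> are nonnegative; dropping them leaves
    \<open>2 * c * t^2\<close>.\<close>
  moreover have "Re (cinner (S (2 * t) x) x') \<le> 0"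
    using negative[OF generator_apply[OF x, of t]] t Re_cinner_commute[of "S t x" "S t x'"]
    by (simp add: cinner_S_double)
  then have "2 * t * g t \<le> 0" using t by (simp add: g_def mult_nonneg_nonpos)
  moreover have "0 \<le> f t" by (simp add: f_def Re_cinner_self)
  ultimately have "2 * c * t\<^sup>2 \<le> (norm x)\<^sup>2" unfolding G_def by linarith
  then show ?thesis by (simp add: c_def mult_ac)
qed

text \<open>For approximants \<open>X n\<close> in the domain with generator values
  \<open>Y n\<close>, the smoothing estimate applied to differences makes \<open>S t (Y n)\<close>
  Cauchy. The limit pair belongs to the generator by the weak test
  \<open>in_generator_iff\<close>.\<close>

lemma S_in_Domain:
  assumes t: "t > 0"
  shows "S t x \<in> Domain (generator S)"
proof -
  have "x \<in> closure (Domain (generator S))" by (simp add: dense)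
  then obtain X where X: "\<And>n. X n \<in> Domain (generator S)" "X \<longlonglongrightarrow> x"
    by (auto simp: closure_sequential)
  then have "\<forall>n. \<exists>y. (X n, y) \<in> generator S" by blast
  then obtain Y where Y: "\<And>n. (X n, Y n) \<in> generator S" by metis
  have bound: "t * norm (S t (Y n) - S t (Y m)) \<le> norm (X n - X m)" for n m
  proof -
    have "2 * t\<^sup>2 * (norm (S t (Y n - Y m)))\<^sup>2 \<le> (norm (X n - X m))\<^sup>2"
      using smoothing_estimate[OF generator_diff[OF Y Y] t] .
    moreover have "0 \<le> t\<^sup>2 * (norm (S t (Y n - Y m)))\<^sup>2" by simp
    ultimately have "(t * norm (S t (Y n - Y m)))\<^sup>2 \<le> (norm (X n - X m))\<^sup>2"
      unfolding power_mult_distrib by linarith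
    then have "t * norm (S t (Y n - Y m)) \<le> norm (X n - X m)" by (rule power2_le_imp_le) simp
    then show ?thesis using t by (simp add: diff)
  qed
  have "Cauchy (\<lambda>n. S t (Y n))"
  proof (rule metric_CauchyI)
    fix e :: real assume e: "e > 0"
    then obtain N where N: "\<forall>n\<ge>N. \<forall>m\<ge>N. dist (X n) (X m) < t * e"
      using metric_CauchyD[OF LIMSEQ_imp_Cauchy[OF X(2)], of "t * e"] t by auto
    have "dist (S t (Y n)) (S t (Y m)) < e" if "n \<ge> N" "m \<ge> N" for n m
    proof -
      have "t * norm (S t (Y n) - S t (Y m)) < t * e"
        using N that bound[of n m] by (fastforce simp: dist_norm)
      then show ?thesis using t by (simp add: dist_norm)
    qed
    then show "\<exists>N. \<forall>n\<ge>N. \<forall>m\<ge>N. dist (S t (Y n)) (S t (Y m)) < e" by blast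
  qed
  then obtain w where w: "(\<lambda>n. S t (Y n)) \<longlonglongrightarrow> w" using Cauchy_convergent convergent_def by blast
  have Sx: "(\<lambda>n. S t (X n)) \<longlonglongrightarrow> S t x"
    using t by (intro bounded_linear.tendsto[OF bounded_linear] X) auto
  have "cinner v (S t x) = cinner u w" if "(u, v) \<in> generator S" for u v
  proof -
    have "cinner v (S t (X n)) = cinner u (S t (Y n))" for n
      using generator_symmetric[OF that generator_apply[OF Y]] t by simp
    then show ?thesis
      using cinner.tendsto[OF tendsto_const Sx, of v] cinner.tendsto[OF tendsto_const w, of u]
      by (simp add: LIMSEQ_unique)
  qed
  then have "(S t x, w) \<in> generator S" using in_generator_iff[of "S t x" w] by blast
  then show ?thesis by blast
qed

text \<open>For \<open>t > 0\<close> smoothing puts the orbit into the domain at the earlier time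
  \<open>e\<close>, from where \<open>has_vector_derivative\<close> applies; at \<open>t = 0\<close>
  the domain hypothesis takes over.\<close>

lemma orbit_differentiable:
  assumes t: "t \<ge> 0" "t > 0 \<or> x \<in> Domain (generator S)"
  shows "\<exists>y. (S t x, y) \<in> generator S \<and> ((\<lambda>t. S t x) has_vector_derivative y) (at t within {0..})"
proof (cases "t = 0")
  case True
  then obtain y where "(x, y) \<in> generator S" using t by auto
  then show ?thesis
    using has_vector_derivative[of x y 0] True by (auto simp: zero)
next
  case False
  define e where "e = t / 2"
  have e: "0 < e" "e < t" using False t by (auto simp: e_def)
  obtain y where y: "(S e x, y) \<in> generator S" using S_in_Domain[OF e(1), of x] by blast
  have at: "at t within {0..} = at t" "at (t - e) within {0..} = at (t - e)"
    using e by (auto intro!: at_within_interior simp: interior_Ici)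
  have "((\<lambda>s. S s (S e x)) has_vector_derivative S (t - e) y) (at (t - e))"
    using has_vector_derivative[OF y, of "t - e"] e at by simp
  moreover have "((\<lambda>s. s - e) has_vector_derivative 1) (at t)"
    by (auto intro!: derivative_eq_intros)
  ultimately
  have "((\<lambda>s. S (s - e) (S e x)) has_vector_derivative S (t - e) y) (at t)"
    using vector_diff_chain_at[of "\<lambda>s. s - e" 1 t "\<lambda>s. S s (S e x)"] by (simp add: o_def)
  then have "((\<lambda>s. S s x) has_vector_derivative S (t - e) y) (at t)"
    by (rule has_vector_derivative_transform_within_open[of _ _ _ "{e<..}"])
      (use e in \<open>auto simp: semigroup[symmetric]\<close>)
  moreover have "(S (t - e) (S e x), S (t - e) y) \<in> generator S" using generator_apply[OF y] e by simp
  then have "(S t x, S (t - e) y) \<in> generator S" using e by (simp add: semigroup[symmetric])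
  ultimately show ?thesis using at by auto
qed

text \<open>Symmetry and the semigroup law distribute the total time \<open>s + t\<close> evenly
  over both arguments, so the cross term is a squared norm.\<close>

lemma norm_diff_S:
  assumes "s \<ge> 0" "t \<ge> 0"
  shows "(norm (S s x - S t x))\<^sup>2 = (norm (S s x))\<^sup>2 + (norm (S t x))\<^sup>2 - 2 * (norm (S ((s + t) / 2) x))\<^sup>2"
proof -
  have *: "2 * ((s + t) / 2) = t + s" by simp
  have "cinner (S s x) (S t x) = cinner (S ((s + t) / 2) x) (S ((s + t) / 2) x)"
    using assms symmetric[of t "S s x" x] semigroup[of t s x]
      cinner_S_double[of "(s + t) / 2" x x, unfolded *]
    by simp
  then show ?thesis by (simp add: norm_diff_squared Re_cinner_self)
qed

lemma antimono_norm: "0 \<le> s \<Longrightarrow> s \<le> t \<Longrightarrow> norm (S t x) \<le> norm (S s x)"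
  using contraction[of "t - s" "S s x"] semigroup[of "t - s" s x] by simp

text \<open>The squared norm \<open>g\<close> decreases towards its infimum \<open>m\<close>. For
  large \<open>s\<close> and \<open>t\<close> all three norms in \<open>norm_diff_S\<close> are
  close to it, their contributions cancel, and the orbit is Cauchy.\<close>

lemma convergent_at_top: "\<exists>y. ((\<lambda>t. S t x) \<longlongrightarrow> y) at_top"
proof -
  define g where "g t = (norm (S t x))\<^sup>2" for t
  define m where "m = Inf (g ` {0..})"
  have bdd: "bdd_below (g ` {0..})" by (auto simp: g_def intro!: bdd_belowI[of _ 0])
  have m: "m \<le> g t" if "t \<ge> 0" for t unfolding m_def using bdd that by (intro cInf_lower) auto
  have close: "\<exists>b\<ge>0. \<forall>s\<ge>b. \<forall>t\<ge>b. norm (S s x - S t x) < e" if e: "e > 0" for e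
  proof -
    \<comment> \<open>Two values below \<open>m + e^2 / 2\<close>, minus twice a value that is at
      least \<open>m\<close>, give less than \<open>e^2\<close>.\<close>
    have "\<exists>y\<in>g ` {0..}. y < m + e\<^sup>2 / 2"
      using cInf_lessD[of "g ` {0..}" "m + e\<^sup>2 / 2"] e unfolding m_def by auto
    then obtain b where b: "b \<ge> 0" "g b < m + e\<^sup>2 / 2" by auto
    have "norm (S s x - S t x) < e" if "s \<ge> b" "t \<ge> b" for s t
    proof -
      have "g s \<le> g b" "g t \<le> g b" unfolding g_def using that b by (auto intro!: power_mono antimono_norm)
      moreover have "m \<le> g ((s + t) / 2)" using that b by (intro m) auto
      ultimately have "(norm (S s x - S t x))\<^sup>2 < e\<^sup>2"
        using norm_diff_S[of s t x] that b unfolding g_def by linarith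
      then show ?thesis using e by (auto intro: power2_less_imp_less)
    qed
    then show ?thesis using b by blast
  qed
  have "Cauchy (\<lambda>n. S (real n) x)"
  proof (rule metric_CauchyI)
    fix e :: real assume "e > 0"
    then obtain b where b: "\<forall>s\<ge>b. \<forall>t\<ge>b. norm (S s x - S t x) < e" using close by blast
    obtain N where "b \<le> real N" using real_arch_simple by blast
    then have "\<forall>n\<ge>N. \<forall>k\<ge>N. norm (S (real n) x - S (real k) x) < e"
      using b by (meson of_nat_mono order_trans)
    then show "\<exists>N. \<forall>n\<ge>N. \<forall>k\<ge>N. dist (S (real n) x) (S (real k) x) < e"
      unfolding dist_norm by blast
  qed
  then obtain y where y: "(\<lambda>n. S (real n) x) \<longlonglongrightarrow> y" using Cauchy_convergent convergent_def by blast
  have "((\<lambda>t. S t x) \<longlongrightarrow> y) at_top"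
  proof (rule tendstoI)
    fix e :: real assume "e > 0"
    then obtain b where b: "\<forall>s\<ge>b. \<forall>t\<ge>b. norm (S s x - S t x) < e / 2" using close[of "e/2"] by auto
    have "eventually (\<lambda>n. dist (S (real n) x) y < e / 2 \<and> b \<le> real n) sequentially"
      using tendstoD[OF y, of "e/2"] \<open>e > 0\<close>
        filterlim_real_sequentially[unfolded filterlim_at_top, rule_format, of b]
      by (simp add: eventually_conj_iff)
    then obtain n where n: "dist (S (real n) x) y < e / 2" "b \<le> real n"
      using eventually_happens' sequentially_bot by blast
    have "dist (S t x) y < e" if "t \<ge> b" for t
    proof -
      have "dist (S t x) (S (real n) x) < e / 2" using b that n by (simp add: dist_norm)
      then show ?thesis using n dist_triangle[of "S t x" y "S (real n) x"] by linarith
    qed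
    then show "eventually (\<lambda>t. dist (S t x) y < e) at_top"
      using eventually_mono[OF eventually_ge_at_top[of b]] by simp
  qed
  then show ?thesis ..
qed

section \<open>The limit operator and the kernel of the generator\<close>

definition limit :: "'a \<Rightarrow> 'a" where
  "limit x = (SOME y. ((\<lambda>t. S t x) \<longlongrightarrow> y) at_top)"

lemma tendsto_limit: "((\<lambda>t. S t x) \<longlongrightarrow> limit x) at_top"
  unfolding limit_def by (rule someI_ex[OF convergent_at_top])

lemma limitI: "eventually (\<lambda>t. f t = S t x) at_top \<Longrightarrow> (f \<longlongrightarrow> y) at_top \<Longrightarrow> limit x = y"
  by (rule tendsto_unique[OF trivial_limit_at_top_linorder tendsto_limit]) (rule Lim_transform_eventually)

lemma eventually_nonneg: "eventually (\<lambda>t::real. t \<ge> 0) at_top"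
  by (rule eventually_ge_at_top)

lemma limit_add: "limit (x + y) = limit x + limit y"
  by (rule limitI[OF eventually_mono[OF eventually_nonneg] tendsto_add[OF tendsto_limit tendsto_limit]])
    (simp add: add)

lemma limit_cscale: "limit (c *\<^sub>C x) = c *\<^sub>C limit x"
proof (rule limitI[OF eventually_mono[OF eventually_nonneg]])
  show "((\<lambda>t. c *\<^sub>C S t x) \<longlongrightarrow> c *\<^sub>C limit x) at_top"
    using bounded_clinear_cscale[of c, where 'a='a]
    unfolding bounded_clinear_def by (intro bounded_linear.tendsto[OF _ tendsto_limit]) blast
qed (simp add: cscale)

lemma bounded_clinear_limit: "bounded_clinear limit"
  unfolding bounded_clinear_def
proof (intro conjI allI bounded_linear_intro[where K=1])
  have "eventually (\<lambda>t. norm (S t x) \<le> norm x) at_top" for x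
    using eventually_nonneg by eventually_elim (rule contraction)
  then show "norm (limit x) \<le> norm x * 1" for x
    using tendsto_upperbound[OF tendsto_norm[OF tendsto_limit]] by auto
qed (auto simp: limit_add limit_cscale scaleR_cscale)

lemma limit_symmetric: "cinner (limit x) y = cinner x (limit y)"
proof (rule tendsto_unique)
  show "((\<lambda>t. cinner (S t x) y) \<longlongrightarrow> cinner (limit x) y) at_top"
    by (intro cinner.tendsto tendsto_limit tendsto_const)
  have "((\<lambda>t. cinner x (S t y)) \<longlongrightarrow> cinner x (limit y)) at_top"
    by (intro cinner.tendsto tendsto_limit tendsto_const)
  moreover have "eventually (\<lambda>t. cinner x (S t y) = cinner (S t x) y) at_top"
    using eventually_nonneg by eventually_elim (simp add: symmetric)
  ultimately show "((\<lambda>t. cinner (S t x) y) \<longlongrightarrow> cinner x (limit y)) at_top"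
    by (rule Lim_transform_eventually)
qed simp

lemma S_limit:
  assumes s: "s \<ge> 0"
  shows "S s (limit x) = limit x"
proof (rule tendsto_unique)
  show "((\<lambda>t. S s (S t x)) \<longlongrightarrow> S s (limit x)) at_top"
    by (rule bounded_linear.tendsto[OF bounded_linear[OF s] tendsto_limit])
  have "((\<lambda>t. S (s + t) x) \<longlongrightarrow> limit x) at_top"
    by (rule filterlim_compose[OF tendsto_limit filterlim_tendsto_add_at_top[OF tendsto_const filterlim_ident]])
  moreover have "eventually (\<lambda>t. S (s + t) x = S s (S t x)) at_top"
    using eventually_nonneg by eventually_elim (simp add: semigroup s)
  ultimately show "((\<lambda>t. S s (S t x)) \<longlongrightarrow> limit x) at_top"
    by (rule Lim_transform_eventually)
qed simp

lemma limit_in_ker: "limit x \<in> ker_oper (generator S)"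
proof -
  have "eventually (\<lambda>t. (S t (limit x) - limit x) /\<^sub>R t = 0) (at_right 0)"
    by (auto simp: eventually_at_filter S_limit intro!: always_eventually)
  then show ?thesis unfolding ker_oper_def generator_def by (simp add: tendsto_eventually)
qed

text \<open>The orbit of a kernel vector has derivative \<open>S s 0 = 0\<close>, so it is constant
  and its limit is the starting vector.\<close>

lemma limit_eq_self:
  assumes "x \<in> ker_oper (generator S)"
  shows "limit x = x"
proof -
  have x: "(x, 0) \<in> generator S" using assms by (simp add: ker_oper_def)
  have S0: "S t 0 = 0" if "t \<ge> 0" for t using bounded_linear[OF that] by (simp add: linear_simps)
  have "S t x = x" if t: "t \<ge> 0" for t
  proof -
    have "((\<lambda>t. S t x) has_derivative (\<lambda>h. 0)) (at s within {0..})" if "s \<in> {0..}" for s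
      using has_vector_derivative[OF x, of s] that by (simp add: has_vector_derivative_def S0)
    then have "S t x = S 0 x"
      using t has_derivative_zero_unique[of "{0..}" "\<lambda>t. S t x" t 0] by auto
    then show ?thesis by (simp add: zero)
  qed
  then show ?thesis
    by (intro limitI[where f="\<lambda>_. x"] eventually_mono[OF eventually_nonneg] tendsto_const) simp
qed

lemma orth_projection_limit: "orth_projection_onto limit (ker_oper (generator S))"
  unfolding orth_projection_onto_def is_projection_def
proof (intro conjI bounded_clinear_limit)
  show "limit \<circ> limit = limit" by (simp add: fun_eq_iff limit_eq_self limit_in_ker)
  show "adj limit = limit" by (rule adj_eqI) (rule limit_symmetric)
  show "range limit = ker_oper (generator S)"
    using limit_in_ker limit_eq_self by (metis image_subset_iff rangeI subsetI subset_antisym)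
qed

end

section \<open>Support projections\<close>

lemma is_projection_D:
  assumes "is_projection P"
  shows "bounded_clinear P" "P (P x) = P x" "cinner (P x) y = cinner x (P y)"
proof -
  show "bounded_clinear P" using assms by (simp add: is_projection_def)
  then show "cinner (P x) y = cinner x (P y)" using assms cinner_adj[of P] by (simp add: is_projection_def)
  have "P \<circ> P = P" using assms by (simp add: is_projection_def)
  then show "P (P x) = P x" by (metis comp_apply)
qed

lemma is_projection_complement:
  assumes "is_projection P"
  shows "is_projection (\<lambda>x. x - P x)"
  unfolding is_projection_def
proof (intro conjI)
  note P = is_projection_D[OF assms]
  show "bounded_clinear (\<lambda>x. x - P x)" using bounded_clinear_diff[OF bounded_clinear_id P(1)] by simp
  show "(\<lambda>x. x - P x) \<circ> (\<lambda>x. x - P x) = (\<lambda>x. x - P x)"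
    by (auto simp: P(2) bounded_clinear_diff_arg[OF P(1)])
  show "adj (\<lambda>x. x - P x) = (\<lambda>x. x - P x)"
    by (rule adj_eqI) (simp add: cinner_diff_left cinner_diff_right P(3))
qed

text \<open>The difference \<open>W\<close> is symmetric and the real part of its quadratic form
  vanishes. At \<open>x + W x\<close> only the cross terms survive, which add up to twice the
  squared norm of \<open>W x\<close>.\<close>

lemma projection_eqI:
  assumes P: "is_projection P" and Q: "is_projection Q" and "op_le P Q" "op_le Q P"
  shows "P = Q"
proof
  fix x
  define W where "W x = Q x - P x" for x
  have zero: "Re (cinner (W x) x) = 0" for x
    using assms(3,4) unfolding op_le_def op_pos_def W_def less_eq_complex_def
    by (simp add: cinner_diff_left) (metis antisym)
  have add: "W (x + y) = W x + W y" for x y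
    using is_projection_D(1)[OF P] is_projection_D(1)[OF Q]
    by (simp add: W_def bounded_clinear_add_arg)
  have sym: "cinner (W x) y = cinner x (W y)" for x y
    using is_projection_D(3)[OF P] is_projection_D(3)[OF Q]
    by (simp add: W_def cinner_diff_left cinner_diff_right)
  have "Re (cinner (W (W x)) x) = (norm (W x))\<^sup>2"
    by (simp add: sym[of "W x"] Re_cinner_self)
  then have "(norm (W x))\<^sup>2 = 0"
    using zero[of "x + W x"] zero[of x] zero[of "W x"]
    by (simp add: add cinner_add_left cinner_add_right Re_cinner_self)
  then show "P x = Q x" by (simp add: W_def)
qed

text \<open>Taking adjoints in \<open>P Q = P\<close> gives \<open>Q P = P\<close>, so
  \<open>Q - P\<close> is a symmetric idempotent and its quadratic form is a squared norm.\<close>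

lemma projection_op_leI:
  assumes P: "is_projection P" and Q: "is_projection Q" and PQ: "\<And>x. P (Q x) = P x"
  shows "op_le P Q"
  unfolding op_le_def op_pos_def
proof
  fix x
  note P = is_projection_D[OF P] and Q = is_projection_D[OF Q]
  have QP: "Q (P x) = P x" for x
    by (rule cinner_ext) (metis P(3) Q(3) PQ)
  have "cinner (Q x - P x) x = cinner (Q (Q x - P x) - P (Q x - P x)) x"
    using P Q by (simp add: bounded_clinear_diff_arg PQ QP)
  also have "\<dots> = cinner (Q x - P x) (Q x - P x)"
    using P(3)[of "Q x - P x" x] Q(3)[of "Q x - P x" x] by (simp add: cinner_diff_left[of _ _ x] cinner_diff_right)
  also have "\<dots> \<ge> 0" by (simp add: cinner_self less_eq_complex_def)
  finally show "0 \<le> cinner (Q x - P x) x" .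
qed

context negative_semigroup
begin

lemma is_projection_limit: "is_projection limit"
  using orth_projection_limit by (simp add: orth_projection_onto_def)

text \<open>The complement of \<open>limit\<close> differs from the identity by kernel vectors, so
  composing with it leaves the generator unchanged. If \<open>Q\<close> does so too,
  \<open>Q (x - Q x) = 0\<close> puts \<open>x - Q x\<close> into the kernel; \<open>limit\<close>
  then fixes it, which yields the criterion of \<open>projection_op_leI\<close>.\<close>

lemma support_projection_generator: "support_projection (generator S) = (\<lambda>x. x - limit x)"
  (is "_ = ?P")
proof -
  let ?A = "generator S"
  have ker: "(limit x, 0) \<in> ?A" for x using limit_in_ker by (simp add: ker_oper_def)
  have zero: "(0, 0) \<in> ?A" using generator_diff[OF ker[of 0] ker[of 0]] by simp
  have P: "is_projection ?P" by (rule is_projection_complement[OF is_projection_limit])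
  \<comment> \<open>One direction subtracts the kernel vector \<open>limit x\<close>; the other adds
    it back by subtracting \<open>0 - limit x\<close>.\<close>
  have "(?P x, y) \<in> ?A \<longleftrightarrow> (x, y) \<in> ?A" for x y
    using generator_diff[OF _ ker, of x y x] generator_diff[OF _ generator_diff[OF zero ker], of "?P x" y x]
    by auto
  then have PA: "{(x, y). (?P x, y) \<in> ?A} = ?A" by auto
  have least: "op_le ?P Q" if Q: "is_projection Q" and QA: "{(x, y). (Q x, y) \<in> ?A} = ?A" for Q
  proof (rule projection_op_leI[OF P Q])
    fix x
    have "(Q (x - Q x), 0) \<in> ?A"
      using zero is_projection_D[OF Q] by (simp add: bounded_clinear_diff_arg)
    then have "(x - Q x, 0) \<in> {(x, y). (Q x, y) \<in> ?A}" by simp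
    then have "(x - Q x, 0) \<in> ?A" unfolding QA .
    then have "limit (x - Q x) = x - Q x" by (intro limit_eq_self) (simp add: ker_oper_def)
    then show "?P (Q x) = ?P x"
      by (simp add: bounded_clinear_diff_arg[OF bounded_clinear_limit] algebra_simps)
  qed
  show ?thesis
    unfolding support_projection_def
  proof (rule the_equality)
    fix R assume R: "is_projection R \<and> {(x, y). (R x, y) \<in> ?A} = ?A \<and>
      (\<forall>Q. is_projection Q \<and> {(x, y). (Q x, y) \<in> ?A} = ?A \<longrightarrow> op_le R Q)"
    then have "op_le R ?P" using P PA by blast
    moreover have "op_le ?P R" using R least by blast
    ultimately show "R = ?P" using R P by (intro projection_eqI) auto
  qed (use P PA least in blast)
qed

end

section \<open>The potential is dissipative\<close>

text \<open>Additivity of \<open>suminf\<close> requires summability. A product of two norms is at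
  most the sum of their squares, so a bounded operator gives terms dominated by a multiple of the
  two square-summable series.\<close>

lemma predual_additive:
  assumes "\<psi> \<in> predual" "bounded_clinear a" "bounded_clinear b"
  shows "\<psi> (\<lambda>x. a x + b x) = \<psi> a + \<psi> b"
proof -
  obtain x y where \<psi>: "\<psi> = (\<lambda>a. \<Sum>n. cinner (a (x n)) (y n))"
    and xy: "summable (\<lambda>n. (norm (x n))\<^sup>2)" "summable (\<lambda>n. (norm (y n))\<^sup>2)"
    using assms(1) unfolding predual_def by blast
  have summable: "summable (\<lambda>n. cinner (a (x n)) (y n))" if a: "bounded_clinear a" for a
  proof -
    obtain K where K: "K \<ge> 0" "\<And>x. norm (a x) \<le> norm x * K"
      using a bounded_linear.nonneg_bounded unfolding bounded_clinear_def by blast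
    have "cmod (cinner (a (x n)) (y n)) \<le> K * ((norm (x n))\<^sup>2 + (norm (y n))\<^sup>2)" for n
    proof -
      have "cmod (cinner (a (x n)) (y n)) \<le> norm (a (x n)) * norm (y n)" by (rule norm_cinner_le)
      also have "\<dots> \<le> (norm (x n) * K) * norm (y n)" by (intro mult_right_mono K) simp
      also have "\<dots> = K * (norm (x n) * norm (y n))" by simp
      also have "\<dots> \<le> K * ((norm (x n))\<^sup>2 + (norm (y n))\<^sup>2)"
        using sum_squares_bound[of "norm (x n)" "norm (y n)"]
          mult_nonneg_nonneg[OF norm_ge_zero norm_ge_zero, of "x n" "y n"]
        by (intro mult_left_mono K) linarith
      finally show ?thesis .
    qed
    then show ?thesis
      by (intro summable_comparison_test'[OF summable_mult[OF summable_add[OF xy]], of 0 _ K]) auto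
  qed
  show ?thesis
    using suminf_add[OF summable summable] assms(2,3) by (simp add: \<psi> cinner_add_left)
qed

text \<open>\<open>M\<close> is its own double commutant, so closure of arbitrary commutants yields
  the algebra operations of \<open>M\<close>, collected in \<open>closed_M\<close>.\<close>

lemma commutant_closed:
  assumes "C \<subseteq> Collect bounded_clinear" "a \<in> commutant C" "b \<in> commutant C"
  shows "(\<lambda>x. a x + b x) \<in> commutant C" "(\<lambda>x. a x - b x) \<in> commutant C" "a \<circ> b \<in> commutant C"
    "id \<in> commutant C"
  using assms unfolding commutant_def
  by (auto simp: bounded_clinear_add bounded_clinear_diff bounded_clinear_comp bounded_clinear_id
      fun_eq_iff bounded_clinear_add_arg bounded_clinear_diff_arg subset_iff)

context gns_space
begin

section \<open>The algebra, the state and the GNS map\<close>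

lemma bounded_clinear_M: "a \<in> M \<Longrightarrow> bounded_clinear a"
  using vna by (auto simp: von_neumann_algebra_def)

lemma adj_M: "a \<in> M \<Longrightarrow> adj a \<in> M"
  using vna by (auto simp: von_neumann_algebra_def)

lemma double_commutant_M: "commutant (commutant M) = M"
  using vna by (simp add: von_neumann_algebra_def)

lemma commutant_bounded_clinear: "commutant C \<subseteq> Collect bounded_clinear"
  by (auto simp: commutant_def)

lemmas closed_M = commutant_closed[OF commutant_bounded_clinear[of M], unfolded double_commutant_M]

lemma id_M: "id \<in> M"
proof -
  \<comment> \<open>\<open>closed_M(4)\<close> carries premises about two elements of
    \<open>M\<close>; the zero operator, which commutes with every linear operator, supplies
    them.\<close>
  have "(\<lambda>x. 0) \<in> commutant (commutant M)"
    by (auto simp: commutant_def bounded_clinear_def fun_eq_iff linear_simps)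
  then show ?thesis using closed_M(4) double_commutant_M by auto
qed

lemma state_normal: "normal_pos M \<nu>"
  using state by (simp add: faithful_normal_state_def)

lemma state_add:
  assumes "a \<in> M" "b \<in> M"
  shows "\<nu> (\<lambda>x. a x + b x) = \<nu> a + \<nu> b"
proof -
  obtain \<psi> where "\<psi> \<in> predual" "\<forall>a\<in>M. \<nu> a = \<psi> a"
    using state_normal by (auto simp: normal_pos_def)
  then show ?thesis
    using predual_additive[of \<psi> a b] assms closed_M(1) bounded_clinear_M by simp
qed

lemma state_diff:
  assumes "a \<in> M" "b \<in> M"
  shows "\<nu> (\<lambda>x. a x - b x) = \<nu> a - \<nu> b"
  using state_add[OF closed_M(2)[OF assms] assms(2)] by simp

lemma state_mono:
  assumes "a \<in> M" "b \<in> M" "op_le a b"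
  shows "Re (\<nu> a) \<le> Re (\<nu> b)"
proof -
  have "(\<lambda>x. b x - a x) \<in> pos_cone M"
    using assms closed_M(2)[of b a] by (simp add: pos_cone_def op_le_def)
  then have "0 \<le> \<nu> (\<lambda>x. b x - a x)" using state_normal by (simp add: normal_pos_def)
  then show ?thesis using state_diff[OF assms(2,1)] by (simp add: less_eq_complex_def)
qed

text \<open>The map \<eta> is given through its inner products and its dense range, so its
  additivity is recovered by pairing with that range.\<close>

lemma eta_diff:
  assumes "a \<in> M" "b \<in> M"
  shows "\<eta> (\<lambda>x. a x - b x) = \<eta> a - \<eta> b"
proof (rule cinner_dense_eqI[OF gns_dense])
  fix z assume "z \<in> \<eta> ` M"
  then obtain c where c: "c \<in> M" "z = \<eta> c" by blast
  have "adj c \<circ> (\<lambda>x. a x - b x) = (\<lambda>x. (adj c \<circ> a) x - (adj c \<circ> b) x)"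
    using bounded_clinear_M[OF adj_M[OF c(1)]] by (auto simp: bounded_clinear_diff_arg)
  then have "cinner (\<eta> (\<lambda>x. a x - b x)) (\<eta> c) = \<nu> (adj c \<circ> a) - \<nu> (adj c \<circ> b)"
    using assms c adj_M closed_M(2,3) by (simp only: gns_inner state_diff)
  then show "cinner (\<eta> (\<lambda>x. a x - b x)) z = cinner (\<eta> a - \<eta> b) z"
    using assms c by (simp add: cinner_diff_left gns_inner)
qed

text \<open>Since \<open>V\<close> is symmetric and kills \<open>\<eta>(1)\<close>, the state is invariant under \<open>T\<close>; the Schwarz inequality
  then makes \<open>\<eta>(a) \<mapsto> \<eta>(T(a))\<close> a contraction.\<close>

lemma potential_dissipative:
  assumes T: "unital_schwarz_map M T"
    and V: "induced_operator M \<eta> (\<lambda>a x. T a x - a x) V"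
    and sym: "adj V = V"
  shows "Re (cinner (V x) x) \<le> 0"
proof (rule dense_continuous_le[OF gns_dense, where f="\<lambda>x. Re (cinner (V x) x)" and g="\<lambda>_. 0"])
  have bV: "bounded_clinear V" and V: "\<And>a. a \<in> M \<Longrightarrow> V (\<eta> a) = \<eta> (\<lambda>x. T a x - a x)"
    using V by (auto simp: induced_operator_def)
  have TM: "T a \<in> M" if "a \<in> M" for a
    using T that by (auto simp: unital_schwarz_map_def linear_map_on_def)
  have \<eta>T: "\<eta> (T a) = \<eta> a + V (\<eta> a)" if "a \<in> M" for a
    using eta_diff[OF TM[OF that] that] V[OF that] by simp
  have "V (\<eta> id) = 0"
    using T \<eta>T[OF id_M] by (simp add: unital_schwarz_map_def)
  then have inv: "\<nu> (T a) = \<nu> a" if a: "a \<in> M" for a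
  proof -
    have "adj id = (id :: 'h \<Rightarrow> 'h)" by (rule adj_eqI) simp
    then have *: "\<nu> b = cinner (\<eta> b) (\<eta> id)" if "b \<in> M" for b
      using gns_inner[OF that id_M] by simp
    \<comment> \<open>Symmetry moves \<open>V\<close> onto \<open>\<eta> id\<close>, where it
      vanishes; pairing with \<open>\<eta> id\<close> computes the state.\<close>
    have "cinner (V (\<eta> a)) (\<eta> id) = 0"
      using cinner_adj[OF bV] \<open>V (\<eta> id) = 0\<close> by (simp add: sym)
    then show ?thesis using a TM by (simp add: * \<eta>T cinner_add_left)
  qed
  show "continuous_on UNIV (\<lambda>x. Re (cinner (V x) x))"
    using bV by (intro continuous_on_Re cinner.continuous_on continuous_on_id linear_continuous_on)
      (simp add: bounded_clinear_def)
  fix x assume "x \<in> \<eta> ` M"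
  then obtain a where a: "a \<in> M" "x = \<eta> a" by blast
  have nrm: "(norm (\<eta> b))\<^sup>2 = Re (\<nu> (adj b \<circ> b))" if "b \<in> M" for b
    using gns_inner[OF that that] by (simp add: Re_cinner_self[symmetric])
  have aa: "adj a \<circ> a \<in> M" by (intro closed_M(3) adj_M a)
  have "(norm (\<eta> (T a)))\<^sup>2 \<le> Re (\<nu> (T (adj a \<circ> a)))"
    unfolding nrm[OF TM[OF a(1)]]
    using T a aa by (intro state_mono closed_M(3) adj_M TM) (auto simp: unital_schwarz_map_def)
  also have "\<dots> = (norm (\<eta> a))\<^sup>2" by (simp only: inv[OF aa] nrm[OF a(1)])
  finally have "norm (\<eta> (T a)) \<le> norm (\<eta> a)" by (rule power2_le_imp_le) simp
  \<comment> \<open>Contractivity and Cauchy-Schwarz bound the form of \<open>1 + V\<close> by the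
    squared norm; subtracting the identity leaves the claim for \<open>V\<close>.\<close>
  then have "norm (\<eta> (T a)) * norm (\<eta> a) \<le> (norm (\<eta> a))\<^sup>2"
    by (simp add: power2_eq_square mult_right_mono)
  then have "Re (cinner (\<eta> (T a)) (\<eta> a)) \<le> (norm (\<eta> a))\<^sup>2"
    using Re_cinner_le[of "\<eta> (T a)" "\<eta> a"] by linarith
  then show "Re (cinner (V x) x) \<le> 0"
    using a by (simp add: \<eta>T cinner_add_left Re_cinner_self)
qed simp

end

section \<open>Perturbation of the Laplacian\<close>

text \<open>An everywhere defined symmetric \<open>V\<close> keeps the domain and passes through the
  adjoint relation: \<open>(y, z)\<close> lies in the adjoint of the sum iff
  \<open>(y, z - V y)\<close> lies in that of \<open>A\<close>.\<close>

lemma self_adjoint_op_add: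
  assumes A: "self_adjoint A" and V: "\<And>x y. cinner (V x) y = cinner x (V y)"
  shows "self_adjoint (op_add A (graph_of V))"
  unfolding self_adjoint_def
proof
  have "Domain (op_add A (graph_of V)) = Domain A"
    by (auto simp: op_add_def graph_of_def)
  then show "closure (Domain (op_add A (graph_of V))) = UNIV"
    using A by (simp add: self_adjoint_def)
  have adjA: "op_adj A = A" using A by (simp add: self_adjoint_def)
  have "(y, z) \<in> op_adj (op_add A (graph_of V)) \<longleftrightarrow> (y, z) \<in> op_add A (graph_of V)" for y z
  proof -
    have *: "cinner (w + V x) y = cinner x z \<longleftrightarrow> cinner w y = cinner x (z - V y)" for x w
      by (simp add: cinner_add_left cinner_diff_right V eq_diff_eq)
    have "(y, z) \<in> op_adj (op_add A (graph_of V)) \<longleftrightarrow> (\<forall>(x, w) \<in> A. cinner (w + V x) y = cinner x z)"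
      by (auto simp: op_adj_def op_add_def graph_of_def)
    also have "\<dots> \<longleftrightarrow> (y, z - V y) \<in> op_adj A"
      by (simp add: * op_adj_def)
    also have "\<dots> \<longleftrightarrow> (y, z) \<in> op_add A (graph_of V)"
      unfolding op_add_def graph_of_def adjA
      by (auto simp: algebra_simps) (metis add.commute add_diff_cancel_left' diff_add_cancel)
    finally show ?thesis .
  qed
  then show "op_adj (op_add A (graph_of V)) = op_add A (graph_of V)" by auto
qed

section \<open>The evolution equation and its long-time limit\<close>

theorem theorem7p1:
  fixes M :: "('h::complex_hilbert \<Rightarrow> 'h) set"
    and \<nu> :: "('h \<Rightarrow> 'h) \<Rightarrow> complex"
    and \<eta> :: "('h \<Rightarrow> 'h) \<Rightarrow> 'g::complex_hilbert"
    and \<Phi> :: "(real \<Rightarrow> 'h) \<Rightarrow> 'k::complex_hilbert"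
    and \<tau> :: "('k \<Rightarrow> 'k) \<Rightarrow> ennreal"
    and U :: "'g \<Rightarrow> 'k oper"
    and \<delta> \<delta>b :: "'n::finite \<Rightarrow> 'h deriv"
    and d :: "complex^'n^'n"
    and L Hq :: "'g oper"
    and T :: "('h \<Rightarrow> 'h) \<Rightarrow> 'h \<Rightarrow> 'h"
    and Vt :: "'g \<Rightarrow> 'g"
    and Tt :: "real \<Rightarrow> 'g \<Rightarrow> 'g"
  assumes "haagerup_setting M \<nu> \<eta> \<Phi> \<tau> U"
    and "collective_DBII M \<nu> \<delta> \<delta>b"
    and "posdef_matrix d"
    and "L = quantum_laplacian M \<eta> d \<delta> \<delta>b"
    and "self_adjoint L"
    and "pos_oper (op_scale (- 1) L)"
    and "\<exists>S. haagerup_setting.L2_Markov_semigroup M \<nu> \<eta> \<Phi> \<tau> U S \<and> generator S = L"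
    and "unital_schwarz_map M T"
    and "map_DBII M \<nu> T"
    and "induced_operator M \<eta> (\<lambda>a x. T a x - a x) Vt"
    and "adj Vt = Vt"
    and "Hq = op_add L (graph_of Vt)"
    and "C0_semigroup Tt"
    and "generator Tt = Hq"
  shows "(\<forall>f0.
      evolution_solution (closed_second_order M \<eta> d \<delta> \<delta>b) Vt Hq f0 (\<lambda>t. Tt t f0) \<and>
      ((\<lambda>t. Tt t f0) \<longlongrightarrow> f0 - support_projection Hq f0) at_top) \<and>
    orth_projection_onto (\<lambda>x. x - support_projection Hq x) (ker_oper Hq)"
proof -
  interpret haagerup_setting M \<nu> \<eta> \<Phi> \<tau> U by fact
  have bV: "bounded_clinear Vt" using assms(10) by (simp add: induced_operator_def)
  have sym: "cinner (Vt x) y = cinner x (Vt y)" for x y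
    using cinner_adj[OF bV] assms(11) by simp
  have L: "L = op_scale (- 1) (closed_second_order M \<eta> d \<delta> \<delta>b)"
    using assms(4) by (simp add: quantum_laplacian_def)
  have minus: "- 1 *\<^sub>C y = - y" for y :: 'g
    using scaleR_cscale[of "- 1" y] by simp
  have neg: "Re (cinner w x) \<le> 0" if "(x, w) \<in> L" for x w
  proof -
    have "(x, - 1 *\<^sub>C w) \<in> op_scale (- 1) L" using that by (auto simp: op_scale_def)
    then have "0 \<le> cinner (- 1 *\<^sub>C w) x" using assms(6) by (auto simp: pos_oper_def)
    then show ?thesis by (simp add: minus cinner_minus_left less_eq_complex_def)
  qed
  \<comment> \<open>\<open>Hq\<close> is a bounded symmetric perturbation of \<open>L\<close>, and
    the real part of its form is a sum of two nonpositive ones.\<close>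
  interpret S: negative_semigroup Tt
  proof
    show "C0_semigroup Tt" by fact
    show "self_adjoint (generator Tt)"
      unfolding assms(14,12) by (intro self_adjoint_op_add assms(5) sym)
    fix x y assume "(x, y) \<in> generator Tt"
    then obtain w where "(x, w) \<in> L" "y = w + Vt x"
      unfolding assms(14,12) by (auto simp: op_add_def graph_of_def)
    then show "Re (cinner y x) \<le> 0"
      using neg[of x w] potential_dissipative[OF assms(8,10,11), of x] by (simp add: cinner_add_left)
  qed
  note Hq = assms(14)
  \<comment> \<open>\<open>L\<close> is minus the closed second-order operator, so every value of
    \<open>Hq\<close> has the form \<open>- y + Vt x\<close> that \<open>evolution_solution\<close>
    demands.\<close>
  have split: "\<exists>y. (x, y) \<in> closed_second_order M \<eta> d \<delta> \<delta>b \<and> w = - y + Vt x"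
    if "(x, w) \<in> Hq" for x w
    using that unfolding assms(12) L by (auto simp: op_add_def graph_of_def op_scale_def minus)
  have sol: "evolution_solution (closed_second_order M \<eta> d \<delta> \<delta>b) Vt Hq f0 (\<lambda>t. Tt t f0)" for f0
    unfolding evolution_solution_def
  proof (intro conjI allI impI)
    show "continuous_on {0..} (\<lambda>t. Tt t f0)" by (rule S.continuous)
    show "Tt 0 f0 = f0" by (rule S.zero)
    fix t :: real assume "0 \<le> t" "0 < t \<or> f0 \<in> Domain Hq"
    then obtain w where w: "(Tt t f0, w) \<in> Hq"
      "((\<lambda>t. Tt t f0) has_vector_derivative w) (at t within {0..})"
      using S.orbit_differentiable[of t f0] Hq by auto
    with split[OF w(1)] show "\<exists>y. (Tt t f0, y) \<in> closed_second_order M \<eta> d \<delta> \<delta>b \<and>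
        (Tt t f0, - y + Vt (Tt t f0)) \<in> Hq \<and>
        ((\<lambda>t. Tt t f0) has_vector_derivative - y + Vt (Tt t f0)) (at t within {0..})"
      by blast
  qed
  have "support_projection Hq = (\<lambda>x. x - S.limit x)"
    using S.support_projection_generator by (simp only: Hq)
  then show ?thesis
    using sol S.tendsto_limit S.orth_projection_limit by (simp add: Hq)
qed

end
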